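(* Let $X,U,Y$ be Banach lattices, let $p\in[1,\infty)$, and let $(A,B,C)$ be an $L^p$-well-posed triplet on $(X,U,Y)$ with associated system $(\Sigma)$, input-output map $\mathbb{F}$ and truncated input-output maps $\mathbb{F}_t$, $t\ge0$. Then the following assertions are equivalent: (i) the system $(\Sigma)$ is externally positive; (ii) the input-output map $\mathbb{F}$ is positive; (iii) the input-output maps $\mathbb{F}_t$ are positive for every $t\ge0$.
   Context: Setting. $A$ generates a $C_0$-semigroup $\mathbb{T}=(T(t))_{t\ge0}$ on $X$; $X_1$ is $D(A)$ with the norm $\Vert(\mu I-A)x\Vert$, and $X_{-1}$ is the completion of $X$ for $\Vert R(\mu,A)x\Vert$ ($\mu\in\rho(A)$); $\mathbb{T}_{-1}$ is the unique extension of $\mathbb{T}$ to a $C_0$-semigroup on $X_{-1}$, with generator $A_{-1}$. Let $B\in\mathcal{L}(U,X_{-1})$ and $\Phi_tu=\int_0^tT_{-1}(t-s)Bu(s)\,ds$. $B$ is an $L^p$-admissible control operator for $A$ if for some $\tau>0$, $\Phi_\tau u\in X$ for all $u\in L^p(\mathbb{R}_+;U)$. Put $Z=X_1+R(\mu,A_{-1})BU$ ($\mu\in\rho(A)$; independent of $\mu$), a Banach space with norm $\Vert z\Vert_Z^2=\inf\{\Vert x\Vert_{X_1}^2+\Vert u\Vert_U^2: z=x+R(\mu,A_{-1})Bu,\ x\in X_1,\ u\in U\}$. Let $\Gamma\in\mathcal{L}(Z,Y)$, $D_\Sigma\in\mathcal{L}(U,Y)$ and $C:=\Gamma_{|D(A)}$.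 $C$ is an $L^p$-admissible observation operator for $A$ if for some (all) $\alpha>0$ there is $\gamma>0$ with $\int_0^\alpha\Vert CT(t)x\Vert^pdt\le\gamma^p\Vert x\Vert^p$ for all $x\in D(A)$. The system $(\Sigma)$ is $$\dot z(t)=A_{-1}z(t)+Bu(t),\quad z(0)=x,\qquad y(t)=\Gamma z(t)+D_\Sigma u(t),\qquad t>0.$$ Let $W^{1,p}_0([0,\tau];U)=\{u\in W^{1,p}([0,\tau];U):u(0)=0\}$; for such $u$ one has $\Phi_tu\in Z$ and one defines $(\mathbb{F}u)(t)=\Gamma\Phi_tu+D_\Sigma u(t)$. $(A,B,C)$ is an $L^p$-well-posed triplet on $(X,U,Y)$ if $B$ is an $L^p$-admissible control operator for $A$, $C$ is an $L^p$-admissible observation operator for $A$, and for every $\tau>0$ there is $\beta>0$ with $\Vert\mathbb{F}u\Vert_{L^p([0,\tau];Y)}\le\beta\Vert u\Vert_{L^p([0,\tau];U)}$ for all $u\in W^{1,p}_0([0,\tau];U)$. Then $\mathbb{F}$ extends uniquely by continuity to a map $L^p_{loc}(\mathbb{R}_+;U)\to L^p_{loc}(\mathbb{R}_+;Y)$ (the input-output map), $x\mapsto CT(\cdot)x$ extends uniquely by continuity to $\Psi:X\to L^p_{loc}(\mathbb{R}_+;Y)$, the state of $(\Sigma)$ is $z(t)=T(t)x+\Phi_tu$ and its output is $y=\Psi x+\mathbb{F}u$ for $(x,u)\in X\times L^p_{loc}(\mathbb{R}_+;U)$. $\mathbb{F}_\tau\in\mathcal{L}(L^p([0,\tau];U),L^p([0,\tau];Y))$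 is the restriction of $\mathbb{F}$ to the interval $[0,\tau]$. An element of an $L^p$-type space is positive if it takes values in the positive cone almost everywhere; an operator is positive if it maps positive elements to positive elements. $(\Sigma)$ is externally positive if the output corresponding to zero initial state is positive for every positive input function $u\in L^p_{loc}(\mathbb{R}_+;U)$. *)

theory Defs
  imports "HOL-Analysis.Analysis"
begin

text \<open>Real scalars; \<^term>\<open>sup x (- x)\<close> is the modulus of \<^term>\<open>x\<close>.\<close>

class banach_lattice = banach + ordered_real_vector + lattice +
  assumes norm_mono_modulus: "sup x (- x) \<le> sup y (- y) \<Longrightarrow> norm x \<le> norm y"

instance real :: banach_lattice
  by standard (auto simp: sup_max)

text \<open>
  The Bochner integral of \<^theory>\<open>HOL-Analysis.Bochner_Integration\<close> is restricted to second countable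
  (that is, separable) value spaces. Here the value spaces are arbitrary: measurability is Bochner's
  strong measurability, and integrals of vector-valued functions are taken with
  \<^const>\<open>Henstock_Kurzweil_Integration.integral\<close>, which coincides with the Bochner integral on every
  Bochner integrable function. Elements of \<open>L\<^sup>p\<close> spaces are represented by functions on the whole
  real line, of which only the values almost everywhere on the set \<open>S\<close> are relevant.
\<close>

definition strongly_measurable_on :: "real set \<Rightarrow> (real \<Rightarrow> 'b::real_normed_vector) \<Rightarrow> bool" where
  "strongly_measurable_on S f \<longleftrightarrow>
     (\<exists>s. (\<forall>n. simple_function (lebesgue_on S) (s n)) \<and>
          (AE t in lebesgue_on S. (\<lambda>n::nat. s n t) \<longlonglongrightarrow> f t))"

definition Lp :: "real \<Rightarrow> real set \<Rightarrow> (real \<Rightarrow> 'b::real_normed_vector) set" where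
  "Lp p S = {f. strongly_measurable_on S f \<and>
                integrable (lebesgue_on S) (\<lambda>t. norm (f t) powr p)}"

definition Lp_norm :: "real \<Rightarrow> real set \<Rightarrow> (real \<Rightarrow> 'b::real_normed_vector) \<Rightarrow> real" where
  "Lp_norm p S f = (LINT t|lebesgue_on S. norm (f t) powr p) powr (1 / p)"

definition Lp_loc :: "real \<Rightarrow> (real \<Rightarrow> 'b::real_normed_vector) set" where
  "Lp_loc p = {f. \<forall>\<tau>>0. f \<in> Lp p {0..\<tau>}}"

definition Lp_loc_tendsto ::
    "real \<Rightarrow> (nat \<Rightarrow> real \<Rightarrow> 'b::real_normed_vector) \<Rightarrow> (real \<Rightarrow> 'b) \<Rightarrow> bool" where
  "Lp_loc_tendsto p fs f \<longleftrightarrow>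
     (\<forall>\<tau>>0. (\<lambda>n. Lp_norm p {0..\<tau>} (\<lambda>t. fs n t - f t)) \<longlonglongrightarrow> 0)"

text \<open>
  \<open>W\<^sup>1\<^sup>,\<^sup>p([0,\<tau>])\<close> consists of the (continuous representatives of the) primitives of \<open>L\<^sup>p\<close> functions;
  the function \<open>v\<close> below is the weak derivative of \<open>u\<close>.
\<close>

definition W1p :: "real \<Rightarrow> real \<Rightarrow> (real \<Rightarrow> 'b::banach) set" where
  "W1p p \<tau> = {u. \<exists>v\<in>Lp p {0..\<tau>}. \<forall>t\<in>{0..\<tau>}. u t = u 0 + integral {0..t} v}"

definition W1p_0 :: "real \<Rightarrow> real \<Rightarrow> (real \<Rightarrow> 'b::banach) set" where
  "W1p_0 p \<tau> = {u \<in> W1p p \<tau>. u 0 = 0}"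

definition C0_semigroup :: "(real \<Rightarrow> 'a::real_normed_vector \<Rightarrow> 'a) \<Rightarrow> bool" where
  "C0_semigroup T \<longleftrightarrow>
     (\<forall>t\<ge>0. bounded_linear (T t)) \<and> T 0 = id \<and>
     (\<forall>s\<ge>0. \<forall>t\<ge>0. T (s + t) = T s \<circ> T t) \<and>
     (\<forall>x. ((\<lambda>t. T t x) \<longlongrightarrow> x) (at_right 0))"

text \<open>An unbounded operator \<open>A\<close> always enters through the semigroup \<open>T\<close> which it generates:
  \<open>D(A)\<close> is \<open>gen_domain T\<close>, \<open>A\<close> is \<open>generator T\<close>, \<open>\<rho>(A)\<close> is \<open>resolvent_set T\<close> and
  \<open>R(\<mu>,A)\<close> is \<open>resolvent T \<mu>\<close>.\<close>

definition gen_domain :: "(real \<Rightarrow> 'a::real_normed_vector \<Rightarrow> 'a) \<Rightarrow> 'a set" where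
  "gen_domain T = {x. \<exists>y. ((\<lambda>h. (T h x - x) /\<^sub>R h) \<longlongrightarrow> y) (at_right 0)}"

definition generator :: "(real \<Rightarrow> 'a::real_normed_vector \<Rightarrow> 'a) \<Rightarrow> 'a \<Rightarrow> 'a" where
  "generator T x = Lim (at_right 0) (\<lambda>h. (T h x - x) /\<^sub>R h)"

definition resolvent :: "(real \<Rightarrow> 'a::real_normed_vector \<Rightarrow> 'a) \<Rightarrow> real \<Rightarrow> 'a \<Rightarrow> 'a" where
  "resolvent T \<mu> = the_inv_into (gen_domain T) (\<lambda>x. \<mu> *\<^sub>R x - generator T x)"

definition resolvent_set :: "(real \<Rightarrow> 'a::real_normed_vector \<Rightarrow> 'a) \<Rightarrow> real set" where
  "resolvent_set T = {\<mu>. bij_betw (\<lambda>x. \<mu> *\<^sub>R x - generator T x) (gen_domain T) UNIV \<and>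
                         bounded_linear (resolvent T \<mu>)}"

text \<open>The completion \<open>X\<^sub>-\<^sub>1\<close> is a complete space \<open>'e\<close> together with a dense embedding \<open>J\<close> of \<open>X\<close> that is
  isometric for the norm \<open>\<parallel>R(\<mu>,A)x\<parallel>\<close>; this determines it up to isometric isomorphism. The
  subspace \<open>X\<close> of \<open>X\<^sub>-\<^sub>1\<close> is \<open>range J\<close>.\<close>

definition extrapolation_space ::
    "(real \<Rightarrow> 'x::banach \<Rightarrow> 'x) \<Rightarrow> real \<Rightarrow> ('x \<Rightarrow> 'e::banach) \<Rightarrow> bool" where
  "extrapolation_space T \<mu> J \<longleftrightarrow>
     linear J \<and> (\<forall>x. norm (J x) = norm (resolvent T \<mu> x)) \<and> closure (range J) = UNIV"

definition extrapolated_semigroup ::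
    "(real \<Rightarrow> 'x::banach \<Rightarrow> 'x) \<Rightarrow> ('x \<Rightarrow> 'e::banach) \<Rightarrow> (real \<Rightarrow> 'e \<Rightarrow> 'e) \<Rightarrow> bool" where
  "extrapolated_semigroup T J Tm \<longleftrightarrow>
     C0_semigroup Tm \<and> (\<forall>t\<ge>0. \<forall>x. Tm t (J x) = J (T t x))"

text \<open>\<open>Tm\<close> stands for the extrapolated semigroup, so that \<open>resolvent Tm \<mu>\<close> is \<open>R(\<mu>,A\<^sub>-\<^sub>1)\<close>.\<close>

definition control_map ::
    "(real \<Rightarrow> 'e::banach \<Rightarrow> 'e) \<Rightarrow> ('u \<Rightarrow> 'e) \<Rightarrow> real \<Rightarrow> (real \<Rightarrow> 'u) \<Rightarrow> 'e" where
  "control_map Tm B t u = integral {0..t} (\<lambda>s. Tm (t - s) (B (u s)))"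

definition Z_space ::
    "(real \<Rightarrow> 'x::banach \<Rightarrow> 'x) \<Rightarrow> real \<Rightarrow> ('x \<Rightarrow> 'e::banach) \<Rightarrow> (real \<Rightarrow> 'e \<Rightarrow> 'e) \<Rightarrow>
     ('u::banach \<Rightarrow> 'e) \<Rightarrow> 'e set" where
  "Z_space T \<mu> J Tm B = {J x + resolvent Tm \<mu> (B u) |x u. x \<in> gen_domain T}"

definition Z_norm ::
    "(real \<Rightarrow> 'x::banach \<Rightarrow> 'x) \<Rightarrow> real \<Rightarrow> ('x \<Rightarrow> 'e::banach) \<Rightarrow> (real \<Rightarrow> 'e \<Rightarrow> 'e) \<Rightarrow>
     ('u::banach \<Rightarrow> 'e) \<Rightarrow> 'e \<Rightarrow> real" where
  "Z_norm T \<mu> J Tm B z =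
     sqrt (Inf {(norm (\<mu> *\<^sub>R x - generator T x))\<^sup>2 + (norm u)\<^sup>2 |x u.
                  x \<in> gen_domain T \<and> z = J x + resolvent Tm \<mu> (B u)})"

definition bounded_linear_on_Z ::
    "(real \<Rightarrow> 'x::banach \<Rightarrow> 'x) \<Rightarrow> real \<Rightarrow> ('x \<Rightarrow> 'e::banach) \<Rightarrow> (real \<Rightarrow> 'e \<Rightarrow> 'e) \<Rightarrow>
     ('u::banach \<Rightarrow> 'e) \<Rightarrow> ('e \<Rightarrow> 'y::banach) \<Rightarrow> bool" where
  "bounded_linear_on_Z T \<mu> J Tm B \<Gamma> \<longleftrightarrow>
     (\<forall>z\<in>Z_space T \<mu> J Tm B. \<forall>w\<in>Z_space T \<mu> J Tm B. \<Gamma> (z + w) = \<Gamma> z + \<Gamma> w) \<and>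
     (\<forall>c. \<forall>z\<in>Z_space T \<mu> J Tm B. \<Gamma> (c *\<^sub>R z) = c *\<^sub>R \<Gamma> z) \<and>
     (\<exists>K. \<forall>z\<in>Z_space T \<mu> J Tm B. norm (\<Gamma> z) \<le> K * Z_norm T \<mu> J Tm B z)"

definition control_system ::
    "(real \<Rightarrow> 'x::banach \<Rightarrow> 'x) \<Rightarrow> real \<Rightarrow> ('x \<Rightarrow> 'e::banach) \<Rightarrow> (real \<Rightarrow> 'e \<Rightarrow> 'e) \<Rightarrow>
     ('u::banach \<Rightarrow> 'e) \<Rightarrow> ('e \<Rightarrow> 'y::banach) \<Rightarrow> ('u \<Rightarrow> 'y) \<Rightarrow> bool" where
  "control_system T \<mu> J Tm B \<Gamma> D \<longleftrightarrow>
     C0_semigroup T \<and> \<mu> \<in> resolvent_set T \<and>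
     extrapolation_space T \<mu> J \<and> extrapolated_semigroup T J Tm \<and>
     bounded_linear B \<and> bounded_linear_on_Z T \<mu> J Tm B \<Gamma> \<and> bounded_linear D"

definition admissible_control ::
    "real \<Rightarrow> ('x \<Rightarrow> 'e::banach) \<Rightarrow> (real \<Rightarrow> 'e \<Rightarrow> 'e) \<Rightarrow> ('u::banach \<Rightarrow> 'e) \<Rightarrow> bool" where
  "admissible_control p J Tm B \<longleftrightarrow>
     (\<exists>\<tau>>0. \<forall>u\<in>Lp p {0..}. control_map Tm B \<tau> u \<in> range J)"

definition admissible_observation ::
    "real \<Rightarrow> (real \<Rightarrow> 'x::banach \<Rightarrow> 'x) \<Rightarrow> ('x \<Rightarrow> 'y::banach) \<Rightarrow> bool" where
  "admissible_observation p T C \<longleftrightarrow>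
     (\<exists>\<alpha>>0. \<exists>\<gamma>>0. \<forall>x\<in>gen_domain T.
        (\<integral>\<^sup>+t. ennreal (norm (C (T t x)) powr p) \<partial>lebesgue_on {0..\<alpha>})
          \<le> ennreal (\<gamma> powr p * norm x powr p))"

definition smooth_io ::
    "(real \<Rightarrow> 'e::banach \<Rightarrow> 'e) \<Rightarrow> ('u::banach \<Rightarrow> 'e) \<Rightarrow> ('e \<Rightarrow> 'y::banach) \<Rightarrow> ('u \<Rightarrow> 'y) \<Rightarrow>
     (real \<Rightarrow> 'u) \<Rightarrow> real \<Rightarrow> 'y" where
  "smooth_io Tm B \<Gamma> D u t = \<Gamma> (control_map Tm B t u) + D (u t)"

text \<open>The observation operator \<open>C\<close>, the restriction of \<open>\<Gamma>\<close> to \<open>D(A)\<close>, is \<open>\<lambda>x. \<Gamma> (J x)\<close>.\<close>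

definition well_posed_triplet ::
    "real \<Rightarrow> (real \<Rightarrow> 'x::banach \<Rightarrow> 'x) \<Rightarrow> ('x \<Rightarrow> 'e::banach) \<Rightarrow> (real \<Rightarrow> 'e \<Rightarrow> 'e) \<Rightarrow>
     ('u::banach \<Rightarrow> 'e) \<Rightarrow> ('e \<Rightarrow> 'y::banach) \<Rightarrow> ('u \<Rightarrow> 'y) \<Rightarrow> bool" where
  "well_posed_triplet p T J Tm B \<Gamma> D \<longleftrightarrow>
     admissible_control p J Tm B \<and>
     admissible_observation p T (\<lambda>x. \<Gamma> (J x)) \<and>
     (\<forall>\<tau>>0. \<exists>\<beta>>0. \<forall>u\<in>W1p_0 p \<tau>.
        smooth_io Tm B \<Gamma> D u \<in> Lp p {0..\<tau>} \<and>
        Lp_norm p {0..\<tau>} (smooth_io Tm B \<Gamma> D u) \<le> \<beta> * Lp_norm p {0..\<tau>} u)"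

text \<open>For a well-posed triplet the following two predicates each determine exactly one operator, up to
  equality almost everywhere of its values. \<open>L\<^sup>p\<^sub>l\<^sub>o\<^sub>c\<close> is metrizable, hence continuity is
  sequential continuity.\<close>

definition extended_output_map ::
    "real \<Rightarrow> (real \<Rightarrow> 'x::banach \<Rightarrow> 'x) \<Rightarrow> ('x \<Rightarrow> 'y::banach) \<Rightarrow> ('x \<Rightarrow> real \<Rightarrow> 'y) \<Rightarrow> bool" where
  "extended_output_map p T C \<Psi> \<longleftrightarrow>
     (\<forall>x. \<Psi> x \<in> Lp_loc p) \<and>
     (\<forall>x\<in>gen_domain T. AE t in lebesgue_on {0..}. \<Psi> x t = C (T t x)) \<and>
     (\<forall>xs x. xs \<longlonglongrightarrow> x \<longrightarrow> Lp_loc_tendsto p (\<lambda>n. \<Psi> (xs n)) (\<Psi> x))"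

definition input_output_map ::
    "real \<Rightarrow> (real \<Rightarrow> 'e::banach \<Rightarrow> 'e) \<Rightarrow> ('u::banach \<Rightarrow> 'e) \<Rightarrow> ('e \<Rightarrow> 'y::banach) \<Rightarrow>
     ('u \<Rightarrow> 'y) \<Rightarrow> ((real \<Rightarrow> 'u) \<Rightarrow> real \<Rightarrow> 'y) \<Rightarrow> bool" where
  "input_output_map p Tm B \<Gamma> D F \<longleftrightarrow>
     (\<forall>u\<in>Lp_loc p. F u \<in> Lp_loc p) \<and>
     (\<forall>u\<in>(\<Inter>\<tau>\<in>{0<..}. W1p_0 p \<tau>).
        AE t in lebesgue_on {0..}. F u t = smooth_io Tm B \<Gamma> D u t) \<and>
     (\<forall>us u. (\<forall>n. us n \<in> Lp_loc p) \<longrightarrow> u \<in> Lp_loc p \<longrightarrow>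
        Lp_loc_tendsto p us u \<longrightarrow> Lp_loc_tendsto p (\<lambda>n. F (us n)) (F u))"

definition truncated_io_map ::
    "((real \<Rightarrow> 'u::zero) \<Rightarrow> real \<Rightarrow> 'y::zero) \<Rightarrow> real \<Rightarrow> (real \<Rightarrow> 'u) \<Rightarrow> real \<Rightarrow> 'y" where
  "truncated_io_map F \<tau> u =
     (\<lambda>t. if t \<in> {0..\<tau>} then F (\<lambda>s. if s \<in> {0..\<tau>} then u s else 0) t else 0)"

definition system_output ::
    "('x \<Rightarrow> real \<Rightarrow> 'y::plus) \<Rightarrow> ((real \<Rightarrow> 'u) \<Rightarrow> real \<Rightarrow> 'y) \<Rightarrow> 'x \<Rightarrow> (real \<Rightarrow> 'u) \<Rightarrow> real \<Rightarrow> 'y" where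
  "system_output \<Psi> F x u = (\<lambda>t. \<Psi> x t + F u t)"

definition positive_on :: "real set \<Rightarrow> (real \<Rightarrow> 'b::{zero,ord}) \<Rightarrow> bool" where
  "positive_on S f \<longleftrightarrow> (AE t in lebesgue_on S. 0 \<le> f t)"

text \<open>\<open>V\<close> is the domain of the operator: a space of functions on \<open>S\<close>.\<close>

definition positive_operator ::
    "(real \<Rightarrow> 'u) set \<Rightarrow> real set \<Rightarrow> ((real \<Rightarrow> 'u::{zero,ord}) \<Rightarrow> real \<Rightarrow> 'y::{zero,ord}) \<Rightarrow> bool" where
  "positive_operator V S F \<longleftrightarrow> (\<forall>u\<in>V. positive_on S u \<longrightarrow> positive_on S (F u))"

definition externally_positive ::
    "real \<Rightarrow> ('x::banach_lattice \<Rightarrow> real \<Rightarrow> 'y::banach_lattice) \<Rightarrow>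
     ((real \<Rightarrow> 'u::banach_lattice) \<Rightarrow> real \<Rightarrow> 'y) \<Rightarrow> bool" where
  "externally_positive p \<Psi> F \<longleftrightarrow>
     (\<forall>u\<in>Lp_loc p. positive_on {0..} u \<longrightarrow> positive_on {0..} (system_output \<Psi> F 0 u))"

end

theory Submission
  imports Defs
begin

text \<open>
  Since \<open>\<Psi> 0 = 0\<close>, the zero-state output is \<open>F u\<close>. The remaining point is causality: almost
  everywhere on \<open>[0,\<sigma>]\<close>, \<open>F u\<close> agrees with \<open>F (1\<^bsub>[0,\<sigma>]\<^esub> u)\<close>. If \<open>u\<close> is \<open>C\<^sup>1\<close> with \<open>u(0) = 0\<close>, bring
  \<open>u\<close> to zero linearly on \<open>[\<sigma>, \<sigma> + 1/n]\<close>: the resulting \<open>v\<^sub>n\<close> lie in \<open>W\<^sup>1\<^sup>,\<^sup>p\<^sub>0\<close>, converge to \<open>1\<^bsub>[0,\<sigma>]\<^esub> u\<close>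
  and satisfy \<open>F v\<^sub>n = F u\<close> on \<open>[0,\<sigma>]\<close>, because \<open>\<Phi>\<^sub>t\<close> sees the input only on \<open>[0,t]\<close>. Continuity of \<open>F\<close> gives
  causality for such \<open>u\<close>, and density of these functions in \<open>L\<^sup>p\<^sub>l\<^sub>o\<^sub>c\<close> gives it in general.
\<close>

subsection \<open>Strong measurability and \<open>L\<^sup>p\<close> spaces\<close>

lemma strongly_measurable_on_cong:
  assumes "strongly_measurable_on S f" "S \<in> sets lebesgue" "\<And>t. t \<in> S \<Longrightarrow> f t = g t"
  shows "strongly_measurable_on S g"
proof -
  obtain s where s: "\<And>n. simple_function (lebesgue_on S) (s n)"
    and lim: "AE t in lebesgue_on S. (\<lambda>n::nat. s n t) \<longlonglongrightarrow> f t"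
    using assms(1) unfolding strongly_measurable_on_def by blast
  have "AE t in lebesgue_on S. (\<lambda>n::nat. s n t) \<longlonglongrightarrow> g t"
    using lim AE_space by eventually_elim (use assms(3) in simp)
  then show ?thesis
    using s unfolding strongly_measurable_on_def by blast
qed

text \<open>Joint continuity carries the approximating simple functions along. Unary maps are
  covered by an \<open>h\<close> that ignores its second argument.\<close>

lemma strongly_measurable_on_compose2:
  fixes h :: "'a::real_normed_vector \<Rightarrow> 'b::real_normed_vector \<Rightarrow> 'c::real_normed_vector"
  assumes "strongly_measurable_on S f" "strongly_measurable_on S g"
    and h: "continuous_on UNIV (\<lambda>z. h (fst z) (snd z))"
  shows "strongly_measurable_on S (\<lambda>t. h (f t) (g t))"
proof -
  obtain r where r: "\<And>n. simple_function (lebesgue_on S) (r n)"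
    and rlim: "AE t in lebesgue_on S. (\<lambda>n::nat. r n t) \<longlonglongrightarrow> f t"
    using assms(1) unfolding strongly_measurable_on_def by blast
  obtain s where s: "\<And>n. simple_function (lebesgue_on S) (s n)"
    and slim: "AE t in lebesgue_on S. (\<lambda>n::nat. s n t) \<longlonglongrightarrow> g t"
    using assms(2) unfolding strongly_measurable_on_def by blast
  have "AE t in lebesgue_on S. (\<lambda>n. h (r n t) (s n t)) \<longlonglongrightarrow> h (f t) (g t)"
    using rlim slim
  proof eventually_elim
    case (elim t)
    from continuous_on_tendsto_compose[OF h tendsto_Pair[OF elim]] show ?case by simp
  qed
  moreover have "simple_function (lebesgue_on S) (\<lambda>t. h (r n t) (s n t))" for n
    by (rule simple_function_compose2[OF r s])
  ultimately show ?thesis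
    unfolding strongly_measurable_on_def by (intro exI[of _ "\<lambda>n t. h (r n t) (s n t)"]) blast
qed

text \<open>Neither set has to contain the other: with \<open>S\<close> inside \<open>R\<close> this
  is extension by zero, with \<open>R\<close> inside \<open>S\<close> it is restriction.\<close>

lemma simple_function_zero_extension:
  assumes s: "simple_function (lebesgue_on S) s" and S: "S \<in> sets lebesgue" and R: "R \<in> sets lebesgue"
  shows "simple_function (lebesgue_on R) (\<lambda>t. if t \<in> S then s t else 0)"
    (is "simple_function _ ?h")
  unfolding simple_function_def
proof safe
  have fin: "finite (s ` S)" and meas: "\<And>x. x \<in> s ` S \<Longrightarrow> s -` {x} \<inter> S \<in> sets lebesgue"
    using s S by (auto simp: simple_function_def sets_restrict_space_iff)
  show "finite (?h ` space (lebesgue_on R))"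
    by (rule finite_subset[of _ "insert 0 (s ` S)"]) (use fin in auto)
  fix x
  have m: "s -` {y} \<inter> S \<in> sets lebesgue" for y
  proof (cases "y \<in> s ` S")
    case False
    then have "s -` {y} \<inter> S = {}" by auto
    then show ?thesis by simp
  qed (rule meas)
  have "?h -` {y} \<inter> R = (if y = 0 then R - S else {}) \<union> ((s -` {y} \<inter> S) \<inter> R)" for y
    by (auto split: if_splits)
  then have "?h -` {y} \<inter> R \<in> sets lebesgue" for y
    using m S R by auto
  then show "?h -` {?h x} \<inter> space (lebesgue_on R) \<in> sets (lebesgue_on R)"
    using R by (auto simp: sets_restrict_space_iff)
qed

lemma strongly_measurable_on_zero_extension:
  assumes "strongly_measurable_on S f" and S: "S \<in> sets lebesgue" and R: "R \<in> sets lebesgue"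
  shows "strongly_measurable_on R (\<lambda>t. if t \<in> S then f t else 0)"
proof -
  obtain s where s: "\<And>n. simple_function (lebesgue_on S) (s n)"
    and lim: "AE t in lebesgue_on S. (\<lambda>n::nat. s n t) \<longlonglongrightarrow> f t"
    using assms(1) unfolding strongly_measurable_on_def by blast
  have "AE t in lebesgue. t \<in> S \<longrightarrow> (\<lambda>n. s n t) \<longlonglongrightarrow> f t"
    using lim S by (simp add: AE_restrict_space_iff)
  then have "AE t in lebesgue. t \<in> R \<longrightarrow>
      (\<lambda>n. if t \<in> S then s n t else 0) \<longlonglongrightarrow> (if t \<in> S then f t else 0)"
    by eventually_elim auto
  then show ?thesis
    using simple_function_zero_extension[OF s S R] R
    unfolding strongly_measurable_on_def
    by (intro exI[of _ "\<lambda>n t. if t \<in> S then s n t else 0"]) (simp add: AE_restrict_space_iff)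
qed

text \<open>The norms of the simple functions are real valued, so their pointwise limit
  \<open>g\<close> is measurable. It agrees with \<open>norm (f t)\<close> wherever the simple
  functions converge, and completeness of Lebesgue measure absorbs the remaining null set.\<close>

lemma strongly_measurable_on_norm:
  assumes "strongly_measurable_on S f" and S: "S \<in> sets lebesgue"
  shows "(\<lambda>t. norm (f t)) \<in> borel_measurable (lebesgue_on S)"
proof -
  obtain s where s: "\<And>n. simple_function (lebesgue_on S) (s n)"
    and lim: "AE t in lebesgue_on S. (\<lambda>n::nat. s n t) \<longlonglongrightarrow> f t"
    using assms(1) unfolding strongly_measurable_on_def by blast
  define g where "g t = lim (\<lambda>n. norm (s n t))" for t
  have "(\<lambda>t. norm (s n t)) \<in> borel_measurable (lebesgue_on S)" for n
    by (rule borel_measurable_simple_function) (rule simple_function_compose1[OF s])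
  then have "g \<in> borel_measurable (lebesgue_on S)"
    unfolding g_def by (rule borel_measurable_lim_metric)
  then have 1: "(\<lambda>t. if t \<in> S then g t else 0) \<in> borel_measurable lebesgue"
    using borel_measurable_if[OF S, of g] by simp
  have "AE t in lebesgue. t \<in> S \<longrightarrow> (\<lambda>n. s n t) \<longlonglongrightarrow> f t"
    using lim S by (simp add: AE_restrict_space_iff)
  then have "AE t in lebesgue. (if t \<in> S then g t else 0) = (if t \<in> S then norm (f t) else 0)"
    by eventually_elim (auto simp: g_def intro!: limI tendsto_norm)
  from borel_measurable_AE[OF 1 this] show ?thesis
    using borel_measurable_if[OF S, of "\<lambda>t. norm (f t)"] by simp
qed

text \<open>Sampling \<open>f\<close> on a grid gives simple functions: only finitely many grid
  points lie in \<open>{0..N}\<close>, and continuity turns convergence of the sample points into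
  convergence of the values.\<close>

lemma continuous_on_imp_strongly_measurable_on:
  fixes f :: "real \<Rightarrow> 'a::real_normed_vector"
  assumes f: "continuous_on {0..N} f"
  shows "strongly_measurable_on {0..N} f"
proof -
  \<comment> \<open>Rounding down to a multiple of \<open>1 / real (Suc n)\<close>, so that the
    sample point never leaves \<open>{0..N}\<close>.\<close>
  define q where "q n t = real_of_int \<lfloor>real (Suc n) * t\<rfloor> / real (Suc n)" for n t
  have bounds: "0 \<le> q n t" "q n t \<le> t" "t - q n t \<le> 1 / real (Suc n)" if "0 \<le> t" for n t
  proof -
    show "0 \<le> q n t" using that by (simp add: q_def)
    show "q n t \<le> t" unfolding q_def by (simp add: divide_le_eq mult.commute)
    have "t - q n t = (real (Suc n) * t - real_of_int \<lfloor>real (Suc n) * t\<rfloor>) / real (Suc n)"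
      unfolding q_def diff_divide_distrib by simp
    also have "\<dots> \<le> 1 / real (Suc n)"
      by (rule divide_right_mono) linarith+
    finally show "t - q n t \<le> 1 / real (Suc n)" .
  qed
  have "simple_function (lebesgue_on {0..N}) (q n)" for n
  proof (rule simple_function_borel_measurable)
    have "q n \<in> borel_measurable lborel"
      unfolding q_def by measurable
    then show "q n \<in> borel_measurable (lebesgue_on {0..N})"
      by (rule measurable_restrict_space1[OF measurable_completion])
    have "q n ` {0..N} \<subseteq> (\<lambda>i. real_of_int i / real (Suc n)) ` {0..\<lfloor>real (Suc n) * N\<rfloor>}"
    proof
      fix y assume "y \<in> q n ` {0..N}"
      then obtain t where t: "0 \<le> t" "t \<le> N" and y: "y = q n t" by auto
      have "real (Suc n) * t \<le> real (Suc n) * N"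
        using t by (intro mult_left_mono) auto
      then have "\<lfloor>real (Suc n) * t\<rfloor> \<in> {0..\<lfloor>real (Suc n) * N\<rfloor>}"
        using t by (simp add: floor_mono del: of_nat_Suc)
      then show "y \<in> (\<lambda>i. real_of_int i / real (Suc n)) ` {0..\<lfloor>real (Suc n) * N\<rfloor>}"
        unfolding y q_def by (rule imageI)
    qed
    then have "finite (q n ` {0..N})"
      by (rule finite_subset) simp
    then show "finite (q n ` space (lebesgue_on {0..N}))"
      by simp
  qed
  then have simple: "simple_function (lebesgue_on {0..N}) (\<lambda>t. f (q n t))" for n
    by (rule simple_function_compose1)
  have "(\<lambda>n. f (q n t)) \<longlonglongrightarrow> f t" if t: "t \<in> {0..N}" for t
  proof (rule continuous_on_tendsto_compose[OF f _ t])
    have q: "q n t \<in> {0..N}" "\<bar>q n t - t\<bar> \<le> inverse (real (Suc n))" for n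
      using bounds[of t n] t by (auto simp: inverse_eq_divide)
    have "(\<lambda>n. q n t - t) \<longlonglongrightarrow> 0"
      by (rule Lim_null_comparison[OF always_eventually LIMSEQ_inverse_real_of_nat])
        (use q(2) in simp)
    then show "(\<lambda>n. q n t) \<longlonglongrightarrow> t"
      by (rule LIM_zero_cancel)
    show "\<forall>\<^sub>F n in sequentially. q n t \<in> {0..N}"
      using q(1) by simp
  qed
  then show ?thesis
    unfolding strongly_measurable_on_def using simple
    by (intro exI[of _ "\<lambda>n t. f (q n t)"]) (auto intro!: AE_I2)
qed

section \<open>Integrals of p-th powers and membership in L^p\<close>

text \<open>The p-th power of the norm. Dropping the root keeps the estimates linear in the
  integrals and leaves the notion of convergence unchanged, see
  \<open>Lp_loc_tendsto_iff\<close>.\<close>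

definition Lp_int :: "real \<Rightarrow> real set \<Rightarrow> (real \<Rightarrow> 'b::real_normed_vector) \<Rightarrow> real" where
  "Lp_int p S f = (LINT t|lebesgue_on S. norm (f t) powr p)"

lemma Lp_int_nonneg: "0 \<le> Lp_int p S f"
  unfolding Lp_int_def by simp

text \<open>Both powers, \<open>p\<close> and \<open>1 / p\<close>, are continuous on the
  nonnegative reals and fix 0.\<close>

lemma Lp_loc_tendsto_iff:
  assumes "0 < p"
  shows "Lp_loc_tendsto p fs f \<longleftrightarrow>
    (\<forall>\<tau>>0. (\<lambda>n. Lp_int p {0..\<tau>} (\<lambda>t. fs n t - f t)) \<longlonglongrightarrow> 0)"
proof -
  have "(\<lambda>n. x n powr (1 / p)) \<longlonglongrightarrow> 0 \<longleftrightarrow> x \<longlonglongrightarrow> 0" if "\<And>n. 0 \<le> x n" for x :: "nat \<Rightarrow> real"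
  proof
    assume "(\<lambda>n. x n powr (1 / p)) \<longlonglongrightarrow> 0"
    then have "(\<lambda>n. (x n powr (1 / p)) powr p) \<longlonglongrightarrow> 0 powr p"
      by (rule tendsto_powr') (use assms in auto)
    then show "x \<longlonglongrightarrow> 0"
      using assms that by (simp add: powr_powr)
  next
    assume "x \<longlonglongrightarrow> 0"
    then have "(\<lambda>n. x n powr (1 / p)) \<longlonglongrightarrow> 0 powr (1 / p)"
      by (rule tendsto_powr') (use assms that in auto)
    then show "(\<lambda>n. x n powr (1 / p)) \<longlonglongrightarrow> 0" by simp
  qed
  then show ?thesis
    unfolding Lp_loc_tendsto_def Lp_norm_def Lp_int_def[symmetric] by (simp add: Lp_int_nonneg)
qed

text \<open>The sum has norm at most twice the larger norm. This crude bound replaces Minkowski's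
  inequality: a constant factor does no harm to limits equal to 0.\<close>

lemma norm_add_powr_le:
  fixes x y :: "'a::real_normed_vector"
  assumes "0 \<le> p"
  shows "norm (x + y) powr p \<le> 2 powr p * (norm x powr p + norm y powr p)"
proof -
  have "norm (x + y) powr p \<le> (2 * max (norm x) (norm y)) powr p"
    by (intro powr_mono2 assms) (use norm_triangle_ineq[of x y] in auto)
  also have "\<dots> = 2 powr p * max (norm x) (norm y) powr p"
    by (simp add: powr_mult)
  also have "max (norm x) (norm y) powr p \<le> norm x powr p + norm y powr p"
    by (simp add: max_def)
  finally show ?thesis by simp
qed

lemma Lp_integrable: "f \<in> Lp p S \<Longrightarrow> integrable (lebesgue_on S) (\<lambda>t. norm (f t) powr p)"
  by (simp add: Lp_def)

text \<open>A majorant of the p-th power settles membership, because strong measurability already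
  makes that power measurable.\<close>

lemma Lp_dominated:
  assumes f: "strongly_measurable_on S f" and S: "S \<in> sets lebesgue"
    and g: "integrable (lebesgue_on S) g"
    and le: "\<And>t. t \<in> S \<Longrightarrow> norm (f t) powr p \<le> g t"
  shows "f \<in> Lp p S"
proof -
  have "(\<lambda>t. norm (f t) powr p) \<in> borel_measurable (lebesgue_on S)"
    using strongly_measurable_on_norm[OF f S] by measurable
  then have "integrable (lebesgue_on S) (\<lambda>t. norm (f t) powr p)"
    by (rule Bochner_Integration.integrable_bound[OF g])
      (auto intro!: AE_I2 intro: order_trans[OF le])
  then show ?thesis using f by (simp add: Lp_def)
qed

lemma Lp_add:
  assumes f: "f \<in> Lp p S" and g: "g \<in> Lp p S" and S: "S \<in> sets lebesgue" and p: "0 \<le> p"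
  shows "(\<lambda>t. f t + g t) \<in> Lp p S"
    and "Lp_int p S (\<lambda>t. f t + g t) \<le> 2 powr p * (Lp_int p S f + Lp_int p S g)"
proof -
  have int: "integrable (lebesgue_on S) (\<lambda>t. 2 powr p * (norm (f t) powr p + norm (g t) powr p))"
    using Lp_integrable[OF f] Lp_integrable[OF g] by simp
  have "strongly_measurable_on S (\<lambda>t. f t + g t)"
    by (rule strongly_measurable_on_compose2) (use f g in \<open>auto simp: Lp_def intro!: continuous_intros\<close>)
  then show Lp: "(\<lambda>t. f t + g t) \<in> Lp p S"
    by (rule Lp_dominated[OF _ S int norm_add_powr_le[OF p]])
  have "Lp_int p S (\<lambda>t. f t + g t) \<le>
      (LINT t|lebesgue_on S. 2 powr p * (norm (f t) powr p + norm (g t) powr p))"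
    unfolding Lp_int_def
    by (intro integral_mono Lp_integrable[OF Lp] int norm_add_powr_le[OF p])
  also have "\<dots> = 2 powr p * (Lp_int p S f + Lp_int p S g)"
    using Lp_integrable[OF f] Lp_integrable[OF g] by (simp add: Lp_int_def)
  finally show "Lp_int p S (\<lambda>t. f t + g t) \<le> 2 powr p * (Lp_int p S f + Lp_int p S g)" .
qed

lemma Lp_scaleR_right:
  fixes f :: "real \<Rightarrow> real"
  assumes f: "f \<in> Lp p S" and S: "S \<in> sets lebesgue"
  shows "(\<lambda>t. f t *\<^sub>R x) \<in> Lp p S"
proof -
  have int: "integrable (lebesgue_on S) (\<lambda>t. norm x powr p * norm (f t) powr p)"
    using Lp_integrable[OF f] by simp
  have "strongly_measurable_on S (\<lambda>t. f t *\<^sub>R x)"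
    by (rule strongly_measurable_on_compose2[where h = "\<lambda>a b. a *\<^sub>R x"])
      (use f in \<open>auto simp: Lp_def intro!: continuous_intros\<close>)
  then show ?thesis
    by (rule Lp_dominated[OF _ S int]) (simp add: powr_mult mult.commute)
qed

lemma Lp_uminus:
  assumes "f \<in> Lp p S"
  shows "(\<lambda>t. - f t) \<in> Lp p S"
  using assms strongly_measurable_on_compose2[of S f f "\<lambda>a b. - a"]
  by (simp add: Lp_def continuous_intros)

lemma Lp_int_minus_commute: "Lp_int p S (\<lambda>t. f t - g t) = Lp_int p S (\<lambda>t. g t - f t)"
  by (simp add: Lp_int_def norm_minus_commute)

lemma Lp_diff:
  assumes "f \<in> Lp p S" "g \<in> Lp p S" "S \<in> sets lebesgue" "0 \<le> p"
  shows "(\<lambda>t. f t - g t) \<in> Lp p S"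
  using Lp_add(1)[OF assms(1) Lp_uminus[OF assms(2)] assms(3,4)] by simp

lemma Lp_int_triangle:
  assumes "f \<in> Lp p S" "g \<in> Lp p S" "h \<in> Lp p S" "S \<in> sets lebesgue" "0 \<le> p"
  shows "Lp_int p S (\<lambda>t. f t - h t) \<le>
    2 powr p * (Lp_int p S (\<lambda>t. f t - g t) + Lp_int p S (\<lambda>t. g t - h t))"
  using Lp_add(2)[OF Lp_diff[OF assms(1,2,4,5)] Lp_diff[OF assms(2,3,4,5)] assms(4,5)] by simp

lemma Lp_zero_extension:
  assumes f: "f \<in> Lp p S" and S: "S \<in> sets lebesgue" and R: "R \<in> sets lebesgue"
  shows "(\<lambda>t. if t \<in> S then f t else 0) \<in> Lp p R"
proof -
  have sm: "strongly_measurable_on R (\<lambda>t. if t \<in> S then f t else 0)"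
    using f by (intro strongly_measurable_on_zero_extension S R) (simp add: Lp_def)
  have "integrable lebesgue (\<lambda>t. indicator S t *\<^sub>R (norm (f t) powr p))"
    using Lp_integrable[OF f] S by (simp add: integrable_restrict_space)
  then have "integrable lebesgue (\<lambda>t. indicator R t *\<^sub>R (indicator S t *\<^sub>R (norm (f t) powr p)))"
    using R by (rule integrable_mult_indicator[rotated])
  then have "integrable (lebesgue_on R) (\<lambda>t. indicator S t *\<^sub>R (norm (f t) powr p))"
    using R by (simp add: integrable_restrict_space)
  then show ?thesis
    by (rule Lp_dominated[OF sm R]) simp
qed

lemma Lp_cong:
  assumes "f \<in> Lp p S" "S \<in> sets lebesgue" "\<And>t. t \<in> S \<Longrightarrow> f t = g t"
  shows "g \<in> Lp p S"
proof (rule Lp_dominated[OF _ assms(2) Lp_integrable[OF assms(1)]])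
  show "strongly_measurable_on S g"
    using assms(1) by (intro strongly_measurable_on_cong[OF _ assms(2,3)]) (simp add: Lp_def)
qed (simp add: assms(3))

lemma Lp_subset:
  assumes "f \<in> Lp p S" "S \<in> sets lebesgue" "R \<in> sets lebesgue" "R \<subseteq> S"
  shows "f \<in> Lp p R"
  by (rule Lp_cong[OF Lp_zero_extension[OF assms(1-3)]]) (use assms in auto)

text \<open>A piecewise function is the sum of the zero extensions of its two pieces.\<close>

lemma Lp_if:
  assumes f: "f \<in> Lp p S" and g: "g \<in> Lp p S" and S: "S \<in> sets lebesgue" and A: "A \<in> sets lebesgue"
    and p: "0 \<le> p"
  shows "(\<lambda>t. if t \<in> A then f t else g t) \<in> Lp p S"
proof -
  have "(\<lambda>t. if t \<in> S \<inter> A then f t else 0) \<in> Lp p S"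
    by (rule Lp_zero_extension[OF Lp_subset[OF f]]) (use S A in auto)
  moreover have "(\<lambda>t. if t \<in> S - A then g t else 0) \<in> Lp p S"
    by (rule Lp_zero_extension[OF Lp_subset[OF g]]) (use S A in auto)
  ultimately have "(\<lambda>t. (if t \<in> S \<inter> A then f t else 0) + (if t \<in> S - A then g t else 0)) \<in> Lp p S"
    by (rule Lp_add(1)[OF _ _ S p])
  then show ?thesis
    by (rule Lp_cong[OF _ S]) auto
qed

lemma Lp_int_subset_mono:
  assumes f: "f \<in> Lp p S" and S: "S \<in> sets lebesgue" and R: "R \<in> sets lebesgue" and "R \<subseteq> S"
  shows "Lp_int p R f \<le> Lp_int p S f"
proof -
  have "Lp_int p R f = (LINT t|lebesgue. indicator R t *\<^sub>R (norm (f t) powr p))"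
    using R by (simp add: Lp_int_def integral_restrict_space)
  also have "\<dots> \<le> (LINT t|lebesgue. indicator S t *\<^sub>R (norm (f t) powr p))"
    using Lp_integrable[OF f] Lp_integrable[OF Lp_subset[OF assms]] S R \<open>R \<subseteq> S\<close>
    by (intro integral_mono) (auto simp: integrable_restrict_space indicator_def)
  also have "\<dots> = Lp_int p S f"
    using S by (simp add: Lp_int_def integral_restrict_space)
  finally show ?thesis .
qed

lemma Lp_bounded:
  assumes f: "strongly_measurable_on {0..N} f" and b: "\<And>t. t \<in> {0..N} \<Longrightarrow> norm (f t) \<le> K"
    and p: "0 \<le> p"
  shows "f \<in> Lp p {0..N}"
proof (rule Lp_dominated[OF f])
  show "integrable (lebesgue_on {0..N}) (\<lambda>t. K powr p)" by simp
  show "norm (f t) powr p \<le> K powr p" if "t \<in> {0..N}" for t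
    using b[OF that] by (intro powr_mono2 p) auto
qed simp

lemma continuous_on_imp_Lp:
  assumes f: "continuous_on {0..N} f" and p: "0 \<le> p"
  shows "f \<in> Lp p {0..N}"
proof -
  have "bounded (f ` {0..N})"
    by (intro compact_imp_bounded compact_continuous_image f) simp
  then obtain K where "\<And>t. t \<in> {0..N} \<Longrightarrow> norm (f t) \<le> K"
    unfolding bounded_iff by blast
  then show ?thesis
    using Lp_bounded[OF continuous_on_imp_strongly_measurable_on[OF f] _ p] by blast
qed

text \<open>The majorant \<open>w\<close> bounds the differences rather than the functions, so its
  p-th power dominates the integrands directly.\<close>

lemma Lp_int_dominated_convergence:
  assumes f: "\<And>n::nat. f n \<in> Lp p S" and g: "g \<in> Lp p S" and S: "S \<in> sets lebesgue" and p: "0 < p"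
    and w: "integrable (lebesgue_on S) (\<lambda>t. w t powr p)"
    and lim: "AE t in lebesgue_on S. (\<lambda>n. f n t) \<longlonglongrightarrow> g t"
    and le: "\<And>n t. t \<in> S \<Longrightarrow> norm (f n t - g t) \<le> w t"
  shows "(\<lambda>n. Lp_int p S (\<lambda>t. f n t - g t)) \<longlonglongrightarrow> 0"
proof -
  have "(\<lambda>n. LINT t|lebesgue_on S. norm (f n t - g t) powr p) \<longlonglongrightarrow> (LINT t|lebesgue_on S. 0)"
  proof (rule integral_dominated_convergence[OF _ _ w])
    show "(\<lambda>t. norm (f n t - g t) powr p) \<in> borel_measurable (lebesgue_on S)" for n
      using Lp_integrable[OF Lp_diff[OF f g S]] p by auto
    show "AE t in lebesgue_on S. norm (norm (f n t - g t) powr p) \<le> w t powr p" for n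
      using le[of _ n] p by (auto intro!: AE_I2 powr_mono2)
    show "AE t in lebesgue_on S. (\<lambda>n. norm (f n t - g t) powr p) \<longlonglongrightarrow> 0"
      using lim
    proof eventually_elim
      case (elim t)
      then have "(\<lambda>n. norm (f n t - g t)) \<longlonglongrightarrow> 0"
        by (simp add: LIM_zero tendsto_norm_zero)
      then have "(\<lambda>n. norm (f n t - g t) powr p) \<longlonglongrightarrow> 0 powr p"
        by (rule tendsto_powr') (use p in auto)
      then show ?case by simp
    qed
  qed simp
  then show ?thesis by (simp add: Lp_int_def)
qed

lemma AE_eq_if_Lp_int_eq_0:
  assumes "f \<in> Lp p S" "g \<in> Lp p S" "S \<in> sets lebesgue" "0 < p" "Lp_int p S (\<lambda>t. f t - g t) = 0"
  shows "AE t in lebesgue_on S. f t = g t"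
proof -
  have "AE t in lebesgue_on S. norm (f t - g t) powr p = 0"
    using assms Lp_integrable[OF Lp_diff[OF assms(1-3)]]
    by (subst integral_nonneg_eq_0_iff_AE[symmetric]) (auto simp: Lp_int_def)
  then show ?thesis by eventually_elim simp
qed

subsection \<open>Density of \<open>C\<^sup>1\<close> functions\<close>

text \<open>Only \<open>{0..}\<close> matters; differentiability on the whole line avoids one-sided derivatives at \<open>0\<close>.\<close>

definition C1_null :: "(real \<Rightarrow> 'b::banach) \<Rightarrow> bool" where
  "C1_null u \<longleftrightarrow> u 0 = 0 \<and>
     (\<exists>u'. continuous_on UNIV u' \<and> (\<forall>t. (u has_vector_derivative u' t) (at t)))"

lemma C1_null_continuous: "C1_null u \<Longrightarrow> continuous_on S u"
  unfolding C1_null_def by (meson continuous_at_imp_continuous_on has_vector_derivative_continuous)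

lemma C1_null_add:
  assumes "C1_null u" "C1_null v"
  shows "C1_null (\<lambda>t. u t + v t)"
proof -
  obtain u' v' where "continuous_on UNIV u'" "\<And>t. (u has_vector_derivative u' t) (at t)"
    "continuous_on UNIV v'" "\<And>t. (v has_vector_derivative v' t) (at t)"
    using assms unfolding C1_null_def by blast
  then show ?thesis
    using assms unfolding C1_null_def
    by (intro conjI exI[of _ "\<lambda>t. u' t + v' t"]) (auto intro!: derivative_intros continuous_intros)
qed

lemma C1_null_scaleR_right:
  fixes u :: "real \<Rightarrow> real"
  assumes "C1_null u"
  shows "C1_null (\<lambda>t. u t *\<^sub>R x)"
proof -
  obtain u' where u': "continuous_on UNIV u'" "\<And>t. (u has_vector_derivative u' t) (at t)"
    using assms unfolding C1_null_def by blast
  have "((\<lambda>t. u t *\<^sub>R x) has_vector_derivative u' t *\<^sub>R x) (at t)" for t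
    by (rule bounded_linear.has_vector_derivative[OF bounded_linear_scaleR_left u'(2)])
  then show ?thesis
    using assms u'(1) unfolding C1_null_def
    by (intro conjI exI[of _ "\<lambda>t. u' t *\<^sub>R x"]) (auto intro!: continuous_intros)
qed

section \<open>Closure of the C^1 functions in L^p on a bounded interval\<close>

text \<open>The L^p closure of the C^1 functions vanishing at 0. What it contains is found stepwise:
  continuous real functions vanishing at 0, indicators, simple functions, all of
  \<open>Lp\<close>.\<close>

definition C1_approximable :: "real \<Rightarrow> real \<Rightarrow> (real \<Rightarrow> 'b::banach) \<Rightarrow> bool" where
  "C1_approximable p N u \<longleftrightarrow> u \<in> Lp p {0..N} \<and>
     (\<forall>\<epsilon>>0. \<exists>w. C1_null w \<and> Lp_int p {0..N} (\<lambda>t. w t - u t) < \<epsilon>)"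

lemma C1_approximable_add:
  assumes "C1_approximable p N u" "C1_approximable p N v" and p: "0 \<le> p"
  shows "C1_approximable p N (\<lambda>t. u t + v t)"
  unfolding C1_approximable_def
proof (intro conjI allI impI)
  have u: "u \<in> Lp p {0..N}" and v: "v \<in> Lp p {0..N}"
    using assms by (simp_all add: C1_approximable_def)
  show "(\<lambda>t. u t + v t) \<in> Lp p {0..N}"
    by (rule Lp_add(1)[OF u v _ p]) simp
  fix \<epsilon> :: real assume "0 < \<epsilon>"
  \<comment> \<open>Two errors below \<open>\<delta>\<close> get amplified by the factor
    \<open>2 powr p\<close> of \<open>Lp_add\<close>.\<close>
  define \<delta> where "\<delta> = \<epsilon> / (2 * 2 powr p)"
  have "0 < \<delta>" using \<open>0 < \<epsilon>\<close> by (simp add: \<delta>_def)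
  then obtain w z where w: "C1_null w" "Lp_int p {0..N} (\<lambda>t. w t - u t) < \<delta>"
    and z: "C1_null z" "Lp_int p {0..N} (\<lambda>t. z t - v t) < \<delta>"
    using assms unfolding C1_approximable_def by meson
  have "Lp_int p {0..N} (\<lambda>t. (w t - u t) + (z t - v t)) \<le>
      2 powr p * (Lp_int p {0..N} (\<lambda>t. w t - u t) + Lp_int p {0..N} (\<lambda>t. z t - v t))"
    by (intro Lp_add(2) Lp_diff continuous_on_imp_Lp C1_null_continuous w z u v p) auto
  also have "\<dots> < 2 powr p * (\<delta> + \<delta>)"
    using w(2) z(2) by (intro mult_strict_left_mono) auto
  also have "\<dots> = \<epsilon>" by (simp add: \<delta>_def)
  finally have "Lp_int p {0..N} (\<lambda>t. (w t + z t) - (u t + v t)) < \<epsilon>"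
    by (simp add: algebra_simps)
  then show "\<exists>x. C1_null x \<and> Lp_int p {0..N} (\<lambda>t. x t - (u t + v t)) < \<epsilon>"
    using C1_null_add[OF w(1) z(1)] by blast
qed

text \<open>Approximating an approximant costs only the constant of
  \<open>Lp_int_triangle\<close>.\<close>

lemma C1_approximable_closure:
  assumes u: "u \<in> Lp p {0..N}" and p: "0 \<le> p"
    and ex: "\<And>\<delta>. 0 < \<delta> \<Longrightarrow> \<exists>v. C1_approximable p N v \<and> Lp_int p {0..N} (\<lambda>t. v t - u t) < \<delta>"
  shows "C1_approximable p N u"
  unfolding C1_approximable_def
proof (intro conjI allI impI u)
  fix \<epsilon> :: real assume "0 < \<epsilon>"
  define \<delta> where "\<delta> = \<epsilon> / (2 * 2 powr p)"
  have "0 < \<delta>" using \<open>0 < \<epsilon>\<close> by (simp add: \<delta>_def)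
  then obtain v where v: "C1_approximable p N v" "Lp_int p {0..N} (\<lambda>t. v t - u t) < \<delta>"
    using ex by blast
  then obtain w where w: "C1_null w" "Lp_int p {0..N} (\<lambda>t. w t - v t) < \<delta>"
    using \<open>0 < \<delta>\<close> unfolding C1_approximable_def by meson
  have "Lp_int p {0..N} (\<lambda>t. w t - u t) \<le>
      2 powr p * (Lp_int p {0..N} (\<lambda>t. w t - v t) + Lp_int p {0..N} (\<lambda>t. v t - u t))"
    using v(1) by (intro Lp_int_triangle[OF continuous_on_imp_Lp[OF C1_null_continuous[OF w(1)] p] _ u _ p])
      (simp_all add: C1_approximable_def)
  also have "\<dots> < 2 powr p * (\<delta> + \<delta>)"
    using w(2) v(2) by (intro mult_strict_left_mono) auto
  also have "\<dots> = \<epsilon>" by (simp add: \<delta>_def)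
  finally show "\<exists>w. C1_null w \<and> Lp_int p {0..N} (\<lambda>t. w t - u t) < \<epsilon>"
    using w(1) by blast
qed

lemma C1_approximable_cong:
  assumes "C1_approximable p N u" "\<And>t. t \<in> {0..N} \<Longrightarrow> u t = v t"
  shows "C1_approximable p N v"
proof -
  have "v \<in> Lp p {0..N}"
    using assms(1) by (intro Lp_cong[OF _ _ assms(2)]) (auto simp: C1_approximable_def)
  moreover have "Lp_int p {0..N} (\<lambda>t. w t - v t) = Lp_int p {0..N} (\<lambda>t. w t - u t)" for w
    unfolding Lp_int_def using assms(2) by (intro Bochner_Integration.integral_cong) auto
  ultimately show ?thesis
    using assms(1) by (simp add: C1_approximable_def)
qed

lemma C1_approximable_scaleR_right:
  fixes u :: "real \<Rightarrow> real"
  assumes u: "C1_approximable p N u"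
  shows "C1_approximable p N (\<lambda>t. u t *\<^sub>R x)"
  unfolding C1_approximable_def
proof (intro conjI allI impI)
  show "(\<lambda>t. u t *\<^sub>R x) \<in> Lp p {0..N}"
    using u by (intro Lp_scaleR_right) (auto simp: C1_approximable_def)
  fix \<epsilon> :: real assume "0 < \<epsilon>"
  \<comment> \<open>The summand 1 keeps the denominator positive for \<open>x = 0\<close>.\<close>
  define \<delta> where "\<delta> = \<epsilon> / (norm x powr p + 1)"
  have pos: "0 < norm x powr p + 1" by (simp add: add_nonneg_pos)
  then have "0 < \<delta>" using \<open>0 < \<epsilon>\<close> by (simp add: \<delta>_def)
  then obtain w where w: "C1_null w" "Lp_int p {0..N} (\<lambda>t. w t - u t) < \<delta>"
    using u unfolding C1_approximable_def by meson
  have "Lp_int p {0..N} (\<lambda>t. w t *\<^sub>R x - u t *\<^sub>R x) = norm x powr p * Lp_int p {0..N} (\<lambda>t. w t - u t)"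
    by (simp add: Lp_int_def powr_mult mult.commute flip: scaleR_left_diff_distrib)
  also have "\<dots> \<le> norm x powr p * \<delta>"
    using w(2) by (intro mult_left_mono) auto
  also have "\<dots> < (norm x powr p + 1) * \<delta>"
    using \<open>0 < \<delta>\<close> by (simp add: distrib_right)
  also have "\<dots> = \<epsilon>" using pos by (simp add: \<delta>_def)
  finally show "\<exists>w. C1_null w \<and> Lp_int p {0..N} (\<lambda>t. w t - u t *\<^sub>R x) < \<epsilon>"
    using C1_null_scaleR_right[OF w(1)] by blast
qed

text \<open>Weierstrass: polynomials are C^1, and subtracting the value at 0 makes them vanish
  there. Since \<open>g 0 = 0\<close>, this at most doubles the uniform error.\<close>

lemma C1_approximable_continuous:
  fixes g :: "real \<Rightarrow> real"
  assumes g: "continuous_on {0..N} g" "g 0 = 0" and N: "0 \<le> N" and p: "0 < p"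
  shows "C1_approximable p N g"
  unfolding C1_approximable_def
proof (intro conjI allI impI)
  show "g \<in> Lp p {0..N}" by (rule continuous_on_imp_Lp[OF g(1)]) (use p in simp)
  fix \<epsilon> :: real assume "0 < \<epsilon>"
  \<comment> \<open>Chosen so that \<open>(2 * \<eta>) powr p\<close> equals
    \<open>\<epsilon> / (N + 1)\<close>, whose integral over \<open>{0..N}\<close> stays below
    \<open>\<epsilon>\<close>, also for \<open>N = 0\<close>.\<close>
  define \<eta> where "\<eta> = (\<epsilon> / (N + 1)) powr (1 / p) / 2"
  have "0 < \<eta>" using \<open>0 < \<epsilon>\<close> N by (simp add: \<eta>_def)
  obtain q where q: "real_polynomial_function q" "\<And>t. t \<in> {0..N} \<Longrightarrow> \<bar>g t - q t\<bar> < \<eta>"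
    using Stone_Weierstrass_real_polynomial_function[OF _ g(1) \<open>0 < \<eta>\<close>] by auto
  then obtain q' where q': "polynomial_function q'" "\<And>t. (q has_vector_derivative q' t) (at t)"
    using has_vector_derivative_polynomial_function[of q] by (auto simp: real_polynomial_function_eq)
  define w where "w t = q t - q 0" for t
  have "C1_null w"
    unfolding C1_null_def w_def using q' continuous_on_polymonial_function[OF q'(1)]
    by (auto intro!: exI[of _ q'] derivative_eq_intros)
  have close: "norm (w t - g t) \<le> 2 * \<eta>" if "t \<in> {0..N}" for t
    using q(2)[OF that] q(2)[of 0] N g(2) by (auto simp: w_def)
  have "Lp_int p {0..N} (\<lambda>t. w t - g t) \<le> (LINT t|lebesgue_on {0..N}. (2 * \<eta>) powr p)"
    unfolding Lp_int_def
  proof (rule integral_mono)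
    show "integrable (lebesgue_on {0..N}) (\<lambda>t. norm (w t - g t) powr p)"
      using p by (intro Lp_integrable continuous_on_imp_Lp continuous_intros g
          C1_null_continuous[OF \<open>C1_null w\<close>]) auto
    show "norm (w t - g t) powr p \<le> (2 * \<eta>) powr p" if "t \<in> space (lebesgue_on {0..N})" for t
      using that close p by (intro powr_mono2) auto
  qed simp
  also have "\<dots> = N * (\<epsilon> / (N + 1))"
    using N p \<open>0 < \<epsilon>\<close> by (simp add: \<eta>_def powr_powr measure_restrict_space)
  also have "\<dots> < \<epsilon>"
    using N \<open>0 < \<epsilon>\<close> by (simp add: field_simps)
  finally show "\<exists>w. C1_null w \<and> Lp_int p {0..N} (\<lambda>t. w t - g t) < \<epsilon>"
    using \<open>C1_null w\<close> by blast
qed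

text \<open>Measurability yields continuous functions converging to the indicator off a negligible
  set; suitably modified, they converge in L^p by dominated convergence.\<close>

lemma C1_approximable_indicator:
  assumes E: "E \<in> sets lebesgue" and N: "0 \<le> N" and p: "0 < p"
  shows "C1_approximable p N (indicator E :: real \<Rightarrow> real)"
proof (rule C1_approximable_closure)
  have ind: "(\<lambda>t. if t \<in> E then 1 else 0::real) \<in> Lp p {0..N}"
    using p E by (intro Lp_if continuous_on_imp_Lp) auto
  show ind: "(indicator E :: real \<Rightarrow> real) \<in> Lp p {0..N}"
    by (rule Lp_cong[OF ind]) (auto simp: indicator_def)
  show "0 \<le> p" using p by simp
  fix \<delta> :: real assume "0 < \<delta>"
  have "(indicator E :: real \<Rightarrow> real) measurable_on UNIV"
    using E by (simp add: measurable_on_iff_borel_measurable)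
  then obtain M and g :: "nat \<Rightarrow> real \<Rightarrow> real" where M: "negligible M" and g: "\<And>n. continuous_on UNIV (g n)"
    and lim: "\<And>t. t \<notin> M \<Longrightarrow> (\<lambda>n. g n t) \<longlonglongrightarrow> indicator E t"
    unfolding measurable_on_def by auto
  \<comment> \<open>Clamping to the unit interval gives a constant majorant. The second factor
    forces the value 0 at \<open>t = 0\<close>, as \<open>C1_approximable_continuous\<close>
    demands, and tends to 1 elsewhere.\<close>
  define h where "h n t = max 0 (min 1 (g n t)) * min 1 (real n * \<bar>t\<bar>)" for n t
  have h: "continuous_on {0..N} (h n)" for n
    unfolding h_def by (intro continuous_intros continuous_on_subset[OF g]) auto
  have h_lim: "(\<lambda>n. h n t) \<longlonglongrightarrow> indicator E t" if "t \<notin> insert 0 M" for t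
  proof -
    have "\<forall>\<^sub>F n in sequentially. 1 / \<bar>t\<bar> \<le> real n"
      by (rule eventually_compose_filterlim[OF eventually_ge_at_top filterlim_real_sequentially])
    then have "\<forall>\<^sub>F n in sequentially. 1 = min 1 (real n * \<bar>t\<bar>)"
      by eventually_elim (use that in \<open>auto simp: field_simps\<close>)
    then have "(\<lambda>n. min 1 (real n * \<bar>t\<bar>)) \<longlonglongrightarrow> 1"
      by (intro tendsto_eventually) (auto elim: eventually_mono)
    then have "(\<lambda>n. h n t) \<longlonglongrightarrow> max 0 (min 1 (indicator E t)) * 1"
      unfolding h_def using that by (intro tendsto_intros lim) auto
    then show ?thesis by (simp add: indicator_def split: if_splits)
  qed
  have "(\<lambda>n. Lp_int p {0..N} (\<lambda>t. h n t - indicator E t)) \<longlonglongrightarrow> 0"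
  proof (rule Lp_int_dominated_convergence[OF _ ind _ p])
    show "h n \<in> Lp p {0..N}" for n
      using p by (intro continuous_on_imp_Lp h) simp
    show "integrable (lebesgue_on {0..N}) (\<lambda>t. 1 powr p)" by simp
    \<comment> \<open>The point 0 joins the exceptional set: \<open>h n\<close> vanishes there even
      if 0 lies in \<open>E\<close>.\<close>
    have "insert 0 M \<in> null_sets lebesgue"
      using M by (metis negligible_iff_null_sets negligible_insert)
    then have "AE t in lebesgue. t \<notin> insert 0 M" by (rule AE_not_in)
    then show "AE t in lebesgue_on {0..N}. (\<lambda>n. h n t) \<longlonglongrightarrow> indicator E t"
      unfolding AE_restrict_space_iff[of "{0..N}" lebesgue, simplified]
      by eventually_elim (use h_lim in blast)
    show "norm (h n t - indicator E t) \<le> 1" for n t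
    proof -
      have "0 \<le> max 0 (min 1 (g n t))" "max 0 (min 1 (g n t)) \<le> 1"
        "0 \<le> min 1 (real n * \<bar>t\<bar>)" "min 1 (real n * \<bar>t\<bar>) \<le> 1" by auto
      then have "0 \<le> h n t" "h n t \<le> 1"
        unfolding h_def by (auto intro: mult_le_one)
      then show ?thesis by (auto simp: indicator_def)
    qed
  qed simp
  then have "\<forall>\<^sub>F n in sequentially. Lp_int p {0..N} (\<lambda>t. h n t - indicator E t) < \<delta>"
    using \<open>0 < \<delta>\<close> by (rule order_tendstoD(2))
  then obtain n where "Lp_int p {0..N} (\<lambda>t. h n t - indicator E t) < \<delta>"
    by (auto dest: eventually_happens)
  moreover have "C1_approximable p N (h n)"
    by (rule C1_approximable_continuous[OF h _ N p]) (simp add: h_def)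
  ultimately show "\<exists>v. C1_approximable p N v \<and> Lp_int p {0..N} (\<lambda>t. v t - indicat_real E t) < \<delta>"
    by blast
qed

text \<open>A simple function is the finite sum of its values times the indicators of its level
  sets.\<close>

lemma C1_approximable_simple_function:
  fixes s :: "real \<Rightarrow> 'b::banach"
  assumes s: "simple_function (lebesgue_on {0..N}) s" and N: "0 \<le> N" and p: "0 < p"
  shows "C1_approximable p N s"
proof -
  define E where "E x = s -` {x} \<inter> {0..N}" for x
  have fin: "finite (s ` {0..N})" and E: "\<And>x. x \<in> s ` {0..N} \<Longrightarrow> E x \<in> sets lebesgue"
    using s by (auto simp: simple_function_def sets_restrict_space_iff E_def)
  have "C1_approximable p N (\<lambda>t. \<Sum>x\<in>A. indicator (E x) t *\<^sub>R x)"
    if "finite A" "A \<subseteq> s ` {0..N}" for A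
    using that
  proof (induction A)
    case empty
    have "C1_approximable p N (\<lambda>t. (indicator {} t :: real) *\<^sub>R (0::'b))"
      by (intro C1_approximable_scaleR_right C1_approximable_indicator N p) simp
    then show ?case by simp
  next
    case (insert x A)
    then show ?case
      using p by (simp add: C1_approximable_add C1_approximable_scaleR_right
          C1_approximable_indicator E N del: sum_indicator_scaleR)
  qed
  from this[OF fin order_refl] show ?thesis
  proof (rule C1_approximable_cong)
    fix t assume t: "t \<in> {0..N}"
    have "(\<Sum>x\<in>s ` {0..N}. indicator (E x) t *\<^sub>R x) = (\<Sum>x\<in>s ` {0..N}. if x = s t then x else 0)"
      using t by (intro sum.cong) (auto simp: E_def indicator_def)
    also have "\<dots> = s t" using fin t by simp
    finally show "(\<Sum>x\<in>s ` {0..N}. indicator (E x) t *\<^sub>R x) = s t" .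
  qed
qed

lemma C1_approximable_Lp:
  fixes u :: "real \<Rightarrow> 'b::banach"
  assumes u: "u \<in> Lp p {0..N}" and N: "0 \<le> N" and p: "0 < p"
  shows "C1_approximable p N u"
proof (rule C1_approximable_closure[OF u])
  show "0 \<le> p" using p by simp
  fix \<delta> :: real assume "0 < \<delta>"
  have S: "{0..N} \<in> sets lebesgue" by simp
  have smu: "strongly_measurable_on {0..N} u" using u by (simp add: Lp_def)
  obtain s where s: "\<And>n. simple_function (lebesgue_on {0..N}) (s n)"
    and lim: "AE t in lebesgue_on {0..N}. (\<lambda>n::nat. s n t) \<longlonglongrightarrow> u t"
    using smu unfolding strongly_measurable_on_def by blast
  \<comment> \<open>Discarding the values of \<open>s n\<close> that are too large makes \<open>3 * norm (u t)\<close> a dominating function.\<close>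
  define r where "r n t = (if norm (s n t) \<le> 2 * norm (u t) then s n t else 0)" for n t
  have r: "simple_function (lebesgue_on {0..N}) (r n)" for n
  proof -
    have [measurable]: "(\<lambda>t. norm (u t)) \<in> borel_measurable (lebesgue_on {0..N})"
      by (rule strongly_measurable_on_norm[OF smu S])
    have [measurable]: "(\<lambda>t. norm (s n t)) \<in> borel_measurable (lebesgue_on {0..N})"
      by (rule borel_measurable_simple_function) (rule simple_function_compose1[OF s])
    show ?thesis
      unfolding r_def by (intro simple_function_If s simple_function_const) measurable
  qed
  have "(\<lambda>n. Lp_int p {0..N} (\<lambda>t. r n t - u t)) \<longlonglongrightarrow> 0"
  proof (rule Lp_int_dominated_convergence[OF _ u S p])
    show "r n \<in> Lp p {0..N}" for n
      using C1_approximable_simple_function[OF r N p] by (simp add: C1_approximable_def)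
    show "integrable (lebesgue_on {0..N}) (\<lambda>t. (3 * norm (u t)) powr p)"
      using Lp_integrable[OF u] by (simp add: powr_mult)
    show "norm (r n t - u t) \<le> 3 * norm (u t)" for n t
      using norm_triangle_ineq4[of "s n t" "u t"] by (auto simp: r_def)
    show "AE t in lebesgue_on {0..N}. (\<lambda>n. r n t) \<longlonglongrightarrow> u t"
      using lim
    proof eventually_elim
      case (elim t)
      \<comment> \<open>If \<open>u t = 0\<close>, the truncation leaves only the value 0. Otherwise
        \<open>norm (s n t)\<close> tends to \<open>norm (u t)\<close>, which is less than
        \<open>2 * norm (u t)\<close>, and the truncation is eventually inactive.\<close>
      show ?case
      proof (cases "u t = 0")
        case True
        then have "(\<lambda>n. r n t) = (\<lambda>n. 0)" by (auto simp: r_def)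
        then show ?thesis using True by simp
      next
        case False
        then have "\<forall>\<^sub>F n in sequentially. norm (s n t) < 2 * norm (u t)"
          by (intro order_tendstoD(2)[OF tendsto_norm[OF elim]]) simp
        then have "\<forall>\<^sub>F n in sequentially. s n t = r n t"
          by eventually_elim (simp add: r_def)
        then show ?thesis using elim by (rule Lim_transform_eventually[rotated])
      qed
    qed
  qed
  then have "\<forall>\<^sub>F n in sequentially. Lp_int p {0..N} (\<lambda>t. r n t - u t) < \<delta>"
    using \<open>0 < \<delta>\<close> by (rule order_tendstoD(2))
  then obtain n where "Lp_int p {0..N} (\<lambda>t. r n t - u t) < \<delta>"
    by (auto dest: eventually_happens)
  then show "\<exists>v. C1_approximable p N v \<and> Lp_int p {0..N} (\<lambda>t. v t - u t) < \<delta>"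
    using C1_approximable_simple_function[OF r N p] by blast
qed

text \<open>Window and accuracy improve together, so every fixed interval eventually lies inside the
  window. Using \<open>Suc n\<close> keeps the window nondegenerate, as \<open>Lp_loc\<close> speaks
  of positive lengths only.\<close>

lemma Lp_loc_dense_C1_null:
  fixes u :: "real \<Rightarrow> 'b::banach"
  assumes u: "u \<in> Lp_loc p" and p: "0 < p"
  obtains w where "\<And>n. C1_null (w n)" "Lp_loc_tendsto p w u"
proof -
  have "\<exists>w. C1_null w \<and> Lp_int p {0..real (Suc n)} (\<lambda>t. w t - u t) < 1 / real (Suc n)" for n
    using C1_approximable_Lp[of u p "real (Suc n)"] u p by (auto simp: Lp_loc_def C1_approximable_def)
  then obtain w where w: "\<And>n. C1_null (w n)"
    "\<And>n. Lp_int p {0..real (Suc n)} (\<lambda>t. w n t - u t) < 1 / real (Suc n)"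
    by metis
  have "(\<lambda>n. Lp_int p {0..\<tau>} (\<lambda>t. w n t - u t)) \<longlonglongrightarrow> 0" for \<tau>
  proof (rule tendsto_sandwich[of "\<lambda>_. 0" _ _ "\<lambda>n. 1 / real (Suc n)"])
    show "\<forall>\<^sub>F n in sequentially. Lp_int p {0..\<tau>} (\<lambda>t. w n t - u t) \<le> 1 / real (Suc n)"
    proof -
      have "\<forall>\<^sub>F n in sequentially. \<tau> \<le> real n"
        by (rule eventually_compose_filterlim[OF eventually_ge_at_top filterlim_real_sequentially])
      then show ?thesis
      proof eventually_elim
        case (elim n)
        have "Lp_int p {0..\<tau>} (\<lambda>t. w n t - u t) \<le> Lp_int p {0..real (Suc n)} (\<lambda>t. w n t - u t)"
          using elim u p
          by (intro Lp_int_subset_mono Lp_diff[OF continuous_on_imp_Lp[OF C1_null_continuous[OF w(1)]]])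
            (auto simp: Lp_loc_def)
        then show ?case using w(2)[of n] by linarith
      qed
    qed
    show "(\<lambda>n. 1 / real (Suc n)) \<longlonglongrightarrow> 0"
      using LIMSEQ_inverse_real_of_nat by (simp add: inverse_eq_divide)
  qed (simp_all add: Lp_int_nonneg)
  then have "Lp_loc_tendsto p w u"
    by (simp add: Lp_loc_tendsto_iff[OF p])
  with w(1) show thesis by (rule that)
qed

subsection \<open>Causality of the input-output map\<close>

text \<open>The fundamental theorem of calculus for the Henstock-Kurzweil integral tolerates
  finitely many points without derivative, which admits the corners of the cutoffs below.\<close>

lemma W1p_0_I:
  assumes S: "finite S" and v: "continuous_on {0..} v" "v 0 = 0"
    and v': "\<And>t. t \<notin> S \<Longrightarrow> (v has_vector_derivative v' t) (at t)" "v' \<in> Lp p {0..\<tau>}"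
  shows "v \<in> W1p_0 p \<tau>"
proof -
  have "v t = integral {0..t} v'" if "t \<in> {0..\<tau>}" for t
  proof -
    have "(v' has_integral v t - v 0) {0..t}"
      using that v' by (intro fundamental_theorem_of_calculus_strong[OF S] continuous_on_subset[OF v(1)]) auto
    then show ?thesis using v(2) by (simp add: integral_unique)
  qed
  then show ?thesis
    using v' v(2) by (auto simp: W1p_0_def W1p_def)
qed

lemma C1_null_W1p_0:
  assumes "C1_null u" "0 \<le> p"
  shows "u \<in> W1p_0 p \<tau>"
proof -
  obtain u' where u': "continuous_on UNIV u'" "\<And>t. (u has_vector_derivative u' t) (at t)"
    using assms unfolding C1_null_def by blast
  show ?thesis
  proof (rule W1p_0_I[of "{}"])
    show "u' \<in> Lp p {0..\<tau>}"
      by (rule continuous_on_imp_Lp[OF continuous_on_subset[OF u'(1)] assms(2)]) simp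
  qed (use assms u' C1_null_continuous in \<open>auto simp: C1_null_def\<close>)
qed

section \<open>Bringing a C^1 input down to zero after a given time\<close>

text \<open>One formula instead of three cases: freezing the argument of \<open>u\<close> at
  \<open>\<sigma>\<close> and multiplying by a clamped ramp makes continuity immediate. The cases
  are recovered in \<open>cutoff_simps\<close>.\<close>

definition cutoff :: "real \<Rightarrow> real \<Rightarrow> (real \<Rightarrow> 'b::real_vector) \<Rightarrow> real \<Rightarrow> 'b" where
  "cutoff \<sigma> \<delta> u t = max 0 (min 1 ((\<sigma> + \<delta> - t) / \<delta>)) *\<^sub>R u (min t \<sigma>)"

lemma cutoff_simps:
  assumes "0 < \<delta>"
  shows "t \<le> \<sigma> \<Longrightarrow> cutoff \<sigma> \<delta> u t = u t"
    and "\<sigma> \<le> t \<Longrightarrow> t \<le> \<sigma> + \<delta> \<Longrightarrow> cutoff \<sigma> \<delta> u t = ((\<sigma> + \<delta> - t) / \<delta>) *\<^sub>R u \<sigma>"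
    and "\<sigma> + \<delta> \<le> t \<Longrightarrow> cutoff \<sigma> \<delta> u t = 0"
proof -
  have "1 \<le> (\<sigma> + \<delta> - t) / \<delta> \<longleftrightarrow> t \<le> \<sigma>" "0 \<le> (\<sigma> + \<delta> - t) / \<delta> \<longleftrightarrow> t \<le> \<sigma> + \<delta>"
    "(\<sigma> + \<delta> - t) / \<delta> \<le> 0 \<longleftrightarrow> \<sigma> + \<delta> \<le> t" "(\<sigma> + \<delta> - t) / \<delta> \<le> 1 \<longleftrightarrow> \<sigma> \<le> t"
    using assms by (auto simp: le_divide_eq divide_le_eq)
  then show "t \<le> \<sigma> \<Longrightarrow> cutoff \<sigma> \<delta> u t = u t"
    and "\<sigma> \<le> t \<Longrightarrow> t \<le> \<sigma> + \<delta> \<Longrightarrow> cutoff \<sigma> \<delta> u t = ((\<sigma> + \<delta> - t) / \<delta>) *\<^sub>R u \<sigma>"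
    and "\<sigma> + \<delta> \<le> t \<Longrightarrow> cutoff \<sigma> \<delta> u t = 0"
    by (simp_all add: cutoff_def min_absorb1 min_absorb2 max_absorb1 max_absorb2)
qed

text \<open>The bound is uniform in \<open>\<delta>\<close>; it supplies the majorant in
  \<open>cutoff_tendsto\<close>.\<close>

lemma norm_cutoff_le:
  assumes "0 < \<delta>" "\<sigma> \<le> t"
  shows "norm (cutoff \<sigma> \<delta> u t) \<le> norm (u \<sigma>)"
proof -
  have "max 0 (min 1 ((\<sigma> + \<delta> - t) / \<delta>)) * norm (u \<sigma>) \<le> 1 * norm (u \<sigma>)"
    by (intro mult_right_mono) auto
  then show ?thesis using assms by (simp add: cutoff_def)
qed

lemma continuous_on_cutoff:
  fixes u :: "real \<Rightarrow> 'b::real_normed_vector"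
  assumes "continuous_on UNIV u" "0 < \<delta>"
  shows "continuous_on S (cutoff \<sigma> \<delta> u)"
  unfolding cutoff_def using assms
  by (intro continuous_intros continuous_on_compose2[OF assms(1)]) auto

lemma cutoff_W1p_0:
  assumes u: "C1_null u" and \<delta>: "0 < \<delta>" and \<sigma>: "0 \<le> \<sigma>" and p: "0 \<le> p"
  shows "cutoff \<sigma> \<delta> u \<in> W1p_0 p \<tau>"
proof -
  obtain u' where u': "continuous_on UNIV u'" "\<And>t. (u has_vector_derivative u' t) (at t)"
    using u unfolding C1_null_def by blast
  \<comment> \<open>The weak derivative: \<open>u'\<close>, then the slope of the ramp, then 0. Its
    values at the corners are arbitrary, and the nested form suits \<open>Lp_if\<close>.\<close>
  define v' where "v' t = (if t \<in> {..\<sigma>} then u' t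
    else if t \<in> {..\<sigma> + \<delta>} then - (1 / \<delta>) *\<^sub>R u \<sigma> else 0)" for t
  have deriv: "(cutoff \<sigma> \<delta> u has_vector_derivative v' t) (at t)" if "t \<notin> {\<sigma>, \<sigma> + \<delta>}" for t
  proof -
    have "t \<noteq> \<sigma>" "t \<noteq> \<sigma> + \<delta>" using that by auto
    then consider "t < \<sigma>" | "\<sigma> < t" "t < \<sigma> + \<delta>" | "\<sigma> + \<delta> < t"
      by linarith
    then show ?thesis
    proof cases
      case 1
      have "(u has_vector_derivative v' t) (at t)"
        using u'(2)[of t] 1 by (simp add: v'_def)
      then show ?thesis
        by (rule has_vector_derivative_transform_within_open[of _ _ _ "{..<\<sigma>}"])
          (use 1 in \<open>simp_all add: cutoff_simps(1)[OF \<delta>]\<close>)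
    next
      case 2
      have "((\<lambda>t. ((\<sigma> + \<delta> - t) / \<delta>) *\<^sub>R u \<sigma>) has_vector_derivative v' t) (at t)"
        using 2 \<delta> unfolding v'_def
        by (auto intro!: derivative_eq_intros simp flip: has_real_derivative_iff_has_vector_derivative)
      then show ?thesis
        by (rule has_vector_derivative_transform_within_open[of _ _ _ "{\<sigma><..<\<sigma> + \<delta>}"])
          (use 2 in \<open>simp_all add: cutoff_simps(2)[OF \<delta>]\<close>)
    next
      case 3
      have "((\<lambda>t. 0) has_vector_derivative v' t) (at t)"
        using 3 \<delta> unfolding v'_def by simp
      then show ?thesis
        by (rule has_vector_derivative_transform_within_open[of _ _ _ "{\<sigma> + \<delta><..}"])
          (use 3 in \<open>simp_all add: cutoff_simps(3)[OF \<delta>]\<close>)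
    qed
  qed
  have "v' \<in> Lp p {0..\<tau>}"
    unfolding v'_def using p
    by (intro Lp_if continuous_on_imp_Lp continuous_on_subset[OF u'(1)] continuous_on_const) auto
  then show ?thesis
    using u \<sigma> cutoff_simps(1)[OF \<delta>, of 0 \<sigma> u]
    by (intro W1p_0_I[of "{\<sigma>, \<sigma> + \<delta>}", OF _ continuous_on_cutoff[OF C1_null_continuous[OF u] \<delta>] _ deriv])
      (simp_all add: C1_null_def)
qed

text \<open>The ramp gets shorter at bounded height, so its contribution to the L^p integral
  vanishes. The slopes may blow up, but continuity of \<open>F\<close> concerns only L^p convergence
  of inputs.\<close>

lemma cutoff_tendsto:
  fixes u :: "real \<Rightarrow> 'b::banach"
  assumes u: "C1_null u" and p: "0 < p"
  shows "Lp_loc_tendsto p (\<lambda>n. cutoff \<sigma> (1 / real (Suc n)) u) (\<lambda>t. if t \<in> {0..\<sigma>} then u t else 0)"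
  unfolding Lp_loc_tendsto_iff[OF p]
proof (intro allI impI)
  fix \<tau> :: real
  let ?v = "\<lambda>n. cutoff \<sigma> (1 / real (Suc n)) u"
  let ?u = "\<lambda>t. if t \<in> {0..\<sigma>} then u t else 0"
  show "(\<lambda>n. Lp_int p {0..\<tau>} (\<lambda>t. ?v n t - ?u t)) \<longlonglongrightarrow> 0"
  proof (rule Lp_int_dominated_convergence[OF _ _ _ p])
    show "?v n \<in> Lp p {0..\<tau>}" for n
      using p by (intro continuous_on_imp_Lp continuous_on_cutoff C1_null_continuous[OF u]) auto
    show "?u \<in> Lp p {0..\<tau>}"
      using p by (intro Lp_if continuous_on_imp_Lp C1_null_continuous[OF u] continuous_on_const) auto
    show "integrable (lebesgue_on {0..\<tau>}) (\<lambda>t. norm (u \<sigma>) powr p)"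
      by simp
    show "norm (?v n t - ?u t) \<le> norm (u \<sigma>)" if "t \<in> {0..\<tau>}" for n t
      using that norm_cutoff_le[of "1 / real (Suc n)" \<sigma> t u]
      by (cases "t \<le> \<sigma>") (auto simp: cutoff_simps(1))
    have "(\<lambda>n. ?v n t) \<longlonglongrightarrow> ?u t" if t: "t \<in> {0..\<tau>}" for t
    proof (cases "t \<le> \<sigma>")
      case True
      then show ?thesis using t by (simp add: cutoff_simps(1))
    next
      case False
      have "\<forall>\<^sub>F n in sequentially. inverse (real (Suc n)) < t - \<sigma>"
        by (rule order_tendstoD(2)[OF LIMSEQ_inverse_real_of_nat]) (use False in simp)
      then have "\<forall>\<^sub>F n in sequentially. ?v n t = 0"
        by eventually_elim (intro cutoff_simps(3); simp add: inverse_eq_divide)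
      then show ?thesis using False by (simp add: tendsto_eventually)
    qed
    then show "AE t in lebesgue_on {0..\<tau>}. (\<lambda>n. ?v n t) \<longlonglongrightarrow> ?u t"
      by (intro AE_I2) simp
  qed simp
qed

section \<open>Limits and truncation in L^p_loc\<close>

lemma Lp_loc_continuous:
  assumes "continuous_on UNIV u" "0 \<le> p"
  shows "u \<in> Lp_loc p"
  unfolding Lp_loc_def using continuous_on_imp_Lp[OF continuous_on_subset[OF assms(1)] assms(2)] by blast

lemma Lp_loc_truncate:
  assumes "u \<in> Lp p {0..\<sigma>}"
  shows "(\<lambda>t. if t \<in> {0..\<sigma>} then u t else 0) \<in> Lp_loc p"
  unfolding Lp_loc_def using Lp_zero_extension[OF assms] by simp

text \<open>Uniqueness of limits, localised to an initial interval: on the way from \<open>f\<close>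
  over \<open>fs n\<close> and \<open>gs n\<close> to \<open>g\<close>, the middle distance is zero
  and the outer ones tend to 0.\<close>

lemma Lp_loc_tendsto_unique:
  assumes fs: "\<And>n. fs n \<in> Lp_loc p" and gs: "\<And>n. gs n \<in> Lp_loc p"
    and f: "f \<in> Lp_loc p" and g: "g \<in> Lp_loc p"
    and eq: "\<And>n. AE t in lebesgue_on {0..\<sigma>}. fs n t = gs n t"
    and limf: "Lp_loc_tendsto p fs f" and limg: "Lp_loc_tendsto p gs g"
    and \<sigma>: "0 < \<sigma>" and p: "0 < p"
  shows "AE t in lebesgue_on {0..\<sigma>}. f t = g t"
proof -
  have Lp: "fs n \<in> Lp p {0..\<sigma>}" "gs n \<in> Lp p {0..\<sigma>}" "f \<in> Lp p {0..\<sigma>}" "g \<in> Lp p {0..\<sigma>}" for n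
    using fs gs f g \<sigma> by (simp_all add: Lp_loc_def)
  have 0: "Lp_int p {0..\<sigma>} (\<lambda>t. fs n t - gs n t) = 0" for n
    unfolding Lp_int_def
    by (rule integral_eq_zero_AE) (use eq[of n] in eventually_elim, simp)
  have le: "Lp_int p {0..\<sigma>} (\<lambda>t. f t - g t) \<le> 2 powr p * (Lp_int p {0..\<sigma>} (\<lambda>t. fs n t - f t) +
      2 powr p * Lp_int p {0..\<sigma>} (\<lambda>t. gs n t - g t))" for n
  proof -
    have "Lp_int p {0..\<sigma>} (\<lambda>t. f t - g t) \<le> 2 powr p *
        (Lp_int p {0..\<sigma>} (\<lambda>t. f t - fs n t) + Lp_int p {0..\<sigma>} (\<lambda>t. fs n t - g t))"
      using Lp p by (intro Lp_int_triangle) auto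
    also have "\<dots> \<le> 2 powr p * (Lp_int p {0..\<sigma>} (\<lambda>t. f t - fs n t) +
        2 powr p * (Lp_int p {0..\<sigma>} (\<lambda>t. fs n t - gs n t) + Lp_int p {0..\<sigma>} (\<lambda>t. gs n t - g t)))"
      using Lp p by (intro mult_left_mono add_left_mono Lp_int_triangle) auto
    finally show ?thesis
      by (simp add: 0 Lp_int_minus_commute[of p "{0..\<sigma>}" f "fs n"])
  qed
  have "(\<lambda>n. 2 powr p * (Lp_int p {0..\<sigma>} (\<lambda>t. fs n t - f t) +
      2 powr p * Lp_int p {0..\<sigma>} (\<lambda>t. gs n t - g t))) \<longlonglongrightarrow> 2 powr p * (0 + 2 powr p * 0)"
    using limf limg \<sigma> by (intro tendsto_intros) (auto simp: Lp_loc_tendsto_iff[OF p])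
  then have "Lp_int p {0..\<sigma>} (\<lambda>t. f t - g t) \<le> 2 powr p * (0 + 2 powr p * 0)"
    by (rule LIMSEQ_le_const) (use le in blast)
  then have "Lp_int p {0..\<sigma>} (\<lambda>t. f t - g t) = 0"
    using Lp_int_nonneg[of p "{0..\<sigma>}" "\<lambda>t. f t - g t"] by simp
  then show ?thesis
    using Lp p by (intro AE_eq_if_Lp_int_eq_0) auto
qed

text \<open>Truncation does not increase pointwise distances.\<close>

lemma Lp_loc_tendsto_truncate:
  assumes us: "\<And>n. us n \<in> Lp_loc p" and u: "u \<in> Lp_loc p" and lim: "Lp_loc_tendsto p us u"
    and \<sigma>: "0 < \<sigma>" and p: "0 < p"
  shows "Lp_loc_tendsto p (\<lambda>n t. if t \<in> {0..\<sigma>} then us n t else 0) (\<lambda>t. if t \<in> {0..\<sigma>} then u t else 0)"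
  unfolding Lp_loc_tendsto_iff[OF p]
proof (intro allI impI)
  fix \<tau> :: real assume \<tau>: "0 < \<tau>"
  let ?d = "\<lambda>n t. (if t \<in> {0..\<sigma>} then us n t else 0) - (if t \<in> {0..\<sigma>} then u t else 0)"
  have "Lp_int p {0..\<tau>} (?d n) \<le> Lp_int p {0..\<tau>} (\<lambda>t. us n t - u t)" for n
  proof -
    have d: "(\<lambda>t. us n t - u t) \<in> Lp p {0..\<tau>}"
      using us u \<tau> p by (intro Lp_diff) (auto simp: Lp_loc_def)
    have "?d n \<in> Lp p {0..\<tau>}"
      using us u \<tau> \<sigma> p Lp_loc_truncate[of "us n" p \<sigma>] Lp_loc_truncate[of u p \<sigma>]
      by (intro Lp_diff) (auto simp: Lp_loc_def)
    then show ?thesis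
      unfolding Lp_int_def by (intro integral_mono Lp_integrable d) auto
  qed
  moreover have "(\<lambda>n. Lp_int p {0..\<tau>} (\<lambda>t. us n t - u t)) \<longlonglongrightarrow> 0"
    using lim \<tau> by (simp add: Lp_loc_tendsto_iff[OF p])
  ultimately show "(\<lambda>n. Lp_int p {0..\<tau>} (?d n)) \<longlonglongrightarrow> 0"
    by - (rule Lim_null_comparison[OF always_eventually], simp_all add: Lp_int_nonneg)
qed

section \<open>Causality, first for C^1 inputs and then in general\<close>

text \<open>The integral sees the inputs on \<open>{0..t}\<close> only, and the feedthrough
  \<open>D\<close> sees the endpoint \<open>t\<close>, which belongs to this interval as
  \<open>0 \<le> t\<close>.\<close>

lemma smooth_io_causal:
  assumes "\<And>s. s \<in> {0..t} \<Longrightarrow> u s = v s" "0 \<le> t"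
  shows "smooth_io Tm B \<Gamma> D u t = smooth_io Tm B \<Gamma> D v t"
proof -
  have "control_map Tm B t u = control_map Tm B t v"
    unfolding control_map_def
    by (rule Henstock_Kurzweil_Integration.integral_cong) (simp add: assms(1))
  then show ?thesis
    using assms by (simp add: smooth_io_def)
qed

lemma input_output_map_Lp_loc:
  "input_output_map p Tm B \<Gamma> D F \<Longrightarrow> u \<in> Lp_loc p \<Longrightarrow> F u \<in> Lp_loc p"
  by (simp add: input_output_map_def)

lemma input_output_map_continuous:
  assumes "input_output_map p Tm B \<Gamma> D F" "\<And>n. us n \<in> Lp_loc p" "u \<in> Lp_loc p" "Lp_loc_tendsto p us u"
  shows "Lp_loc_tendsto p (\<lambda>n. F (us n)) (F u)"
proof -
  have "\<forall>us u. (\<forall>n. us n \<in> Lp_loc p) \<longrightarrow> u \<in> Lp_loc p \<longrightarrow> Lp_loc_tendsto p us u \<longrightarrow>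
      Lp_loc_tendsto p (\<lambda>n. F (us n)) (F u)"
    using assms(1) unfolding input_output_map_def by (elim conjE)
  then show ?thesis using assms(2-4) by simp
qed

lemma input_output_map_causal_C1_null:
  assumes F: "input_output_map p Tm B \<Gamma> D F" and u: "C1_null u" and \<sigma>: "0 < \<sigma>" and p: "0 < p"
  shows "AE t in lebesgue_on {0..\<sigma>}. F u t = F (\<lambda>s. if s \<in> {0..\<sigma>} then u s else 0) t"
proof -
  \<comment> \<open>The sharp truncation jumps at \<open>\<sigma>\<close> unless \<open>u\<close>
    vanishes there, so \<open>smooth_io\<close> is compared with \<open>F\<close> on these
    continuous cutoffs instead.\<close>
  define v where "v n = cutoff \<sigma> (1 / real (Suc n)) u" for n
  have uW: "u \<in> (\<Inter>\<tau>\<in>{0<..}. W1p_0 p \<tau>)"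
    using C1_null_W1p_0[OF u] p by simp
  have vW: "v n \<in> (\<Inter>\<tau>\<in>{0<..}. W1p_0 p \<tau>)" for n
    unfolding v_def using cutoff_W1p_0[OF u] \<sigma> p by simp
  have uL: "u \<in> Lp_loc p"
    using p by (intro Lp_loc_continuous C1_null_continuous[OF u]) simp
  have vL: "v n \<in> Lp_loc p" for n
    unfolding v_def using p by (intro Lp_loc_continuous continuous_on_cutoff C1_null_continuous[OF u]) auto
  have tL: "(\<lambda>s. if s \<in> {0..\<sigma>} then u s else 0) \<in> Lp_loc p"
    using uL \<sigma> by (intro Lp_loc_truncate) (simp add: Lp_loc_def)
  have eq: "AE t in lebesgue_on {0..\<sigma>}. F u t = F (v n) t" for n
  proof -
    have "AE t in lebesgue_on {0..}. F u t = smooth_io Tm B \<Gamma> D u t"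
      and "AE t in lebesgue_on {0..}. F (v n) t = smooth_io Tm B \<Gamma> D (v n) t"
      using F uW vW unfolding input_output_map_def by blast+
    then have "AE t in lebesgue. t \<in> {0..} \<longrightarrow> F u t = smooth_io Tm B \<Gamma> D u t"
      and "AE t in lebesgue. t \<in> {0..} \<longrightarrow> F (v n) t = smooth_io Tm B \<Gamma> D (v n) t"
      by (simp_all add: AE_restrict_space_iff)
    then have "AE t in lebesgue. t \<in> {0..\<sigma>} \<longrightarrow> F u t = F (v n) t"
    proof eventually_elim
      case (elim t)
      show ?case
      proof
        assume t: "t \<in> {0..\<sigma>}"
        then have "smooth_io Tm B \<Gamma> D u t = smooth_io Tm B \<Gamma> D (v n) t"
          by (intro smooth_io_causal) (auto simp: v_def cutoff_simps(1))
        then show "F u t = F (v n) t" using elim t by simp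
      qed
    qed
    then show ?thesis by (simp add: AE_restrict_space_iff)
  qed
  have lim: "Lp_loc_tendsto p (\<lambda>n. F (v n)) (F (\<lambda>s. if s \<in> {0..\<sigma>} then u s else 0))"
    by (rule input_output_map_continuous[OF F vL tL cutoff_tendsto[OF u p, of \<sigma>, folded v_def]])
  note FL = input_output_map_Lp_loc[OF F]
  \<comment> \<open>The constant sequence \<open>F u\<close> is compared with
    \<open>F (v n)\<close>: they agree on \<open>{0..\<sigma>}\<close>, hence so do their
    limits.\<close>
  have "Lp_loc_tendsto p (\<lambda>n::nat. F u) (F u)"
    by (simp add: Lp_loc_tendsto_def Lp_norm_def)
  from Lp_loc_tendsto_unique[OF FL[OF uL] FL[OF vL] FL[OF uL] FL[OF tL] eq this lim \<sigma> p]
  show ?thesis .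
qed

text \<open>Both sides are limits along a C^1 approximation of \<open>u\<close>: the left one by
  continuity of \<open>F\<close>, the right one because truncation is continuous too.\<close>

lemma input_output_map_causal:
  fixes u :: "real \<Rightarrow> 'u::banach"
  assumes F: "input_output_map p Tm B \<Gamma> D F" and u: "u \<in> Lp_loc p" and \<sigma>: "0 < \<sigma>" and p: "0 < p"
  shows "AE t in lebesgue_on {0..\<sigma>}. F u t = F (\<lambda>s. if s \<in> {0..\<sigma>} then u s else 0) t"
proof -
  obtain w where w: "\<And>n. C1_null (w n)" and lim: "Lp_loc_tendsto p w u"
    using Lp_loc_dense_C1_null[OF u p] by blast
  let ?t = "\<lambda>v s. if s \<in> {0..\<sigma>} then v s else (0::'u)"
  have wL: "w n \<in> Lp_loc p" for n
    using p by (intro Lp_loc_continuous C1_null_continuous[OF w]) simp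
  have tL: "?t v \<in> Lp_loc p" if "v \<in> Lp_loc p" for v
    using that \<sigma> by (intro Lp_loc_truncate) (simp add: Lp_loc_def)
  note FL = input_output_map_Lp_loc[OF F] and cont = input_output_map_continuous[OF F]
  show ?thesis
    by (rule Lp_loc_tendsto_unique[OF FL[OF wL] FL[OF tL[OF wL]] FL[OF u] FL[OF tL[OF u]]
          input_output_map_causal_C1_null[OF F w \<sigma> p] cont[OF wL u lim]
          cont[OF tL[OF wL] tL[OF u] Lp_loc_tendsto_truncate[OF wL u lim \<sigma> p]] \<sigma> p])
qed

section \<open>Zero initial state and positivity\<close>

text \<open>\<open>\<Gamma>\<close> is linear on \<open>Z_space\<close> only, so homogeneity with
  the scalar 0 is applied at an explicit element of that space.\<close>

lemma bounded_linear_on_Z_zero: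
  assumes "bounded_linear_on_Z T \<mu> J Tm B \<Gamma>" "0 \<in> gen_domain T"
  shows "\<Gamma> 0 = 0"
proof -
  have "J 0 + resolvent Tm \<mu> (B 0) \<in> Z_space T \<mu> J Tm B"
    using assms(2) unfolding Z_space_def by blast
  then have "\<Gamma> (0 *\<^sub>R (J 0 + resolvent Tm \<mu> (B 0))) = 0 *\<^sub>R \<Gamma> (J 0 + resolvent Tm \<mu> (B 0))"
    using assms(1) unfolding bounded_linear_on_Z_def by blast
  then show ?thesis by simp
qed

text \<open>The formula for \<open>\<Psi>\<close> is available on \<open>gen_domain T\<close>, which
  contains 0; \<open>T t\<close>, \<open>J\<close> and \<open>\<Gamma>\<close> all preserve
  0.\<close>

lemma extended_output_map_zero:
  assumes "control_system T \<mu> J Tm B \<Gamma> D" "extended_output_map p T (\<lambda>x. \<Gamma> (J x)) \<Psi>"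
  shows "AE t in lebesgue_on {0..}. \<Psi> 0 t = 0"
proof -
  have T0: "T t 0 = 0" if "0 \<le> t" for t
    using assms(1) that unfolding control_system_def C0_semigroup_def
    by (meson bounded_linear.linear linear_0)
  have "((\<lambda>h. (T h 0 - 0) /\<^sub>R h) \<longlongrightarrow> 0) (at_right 0)"
    by (rule tendsto_eventually) (auto simp: eventually_at_right_field T0 intro: exI[of _ 1])
  then have dom: "0 \<in> gen_domain T" unfolding gen_domain_def by blast
  have "J 0 = 0"
    using assms(1) unfolding control_system_def extrapolation_space_def by (meson linear_0)
  moreover have "\<Gamma> 0 = 0"
    using assms(1) dom unfolding control_system_def by (blast intro: bounded_linear_on_Z_zero)
  moreover have "AE t in lebesgue_on {0..}. \<Psi> 0 t = \<Gamma> (J (T t 0))"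
    using assms(2) dom unfolding extended_output_map_def by blast
  ultimately show ?thesis
    by (simp add: AE_restrict_space_iff T0)
qed

text \<open>Statements on different intervals become statements about one measure, so that their
  null sets can be combined.\<close>

lemma positive_on_iff: "S \<in> sets lebesgue \<Longrightarrow>
    positive_on S f \<longleftrightarrow> (AE t in lebesgue. t \<in> S \<longrightarrow> 0 \<le> f t)"
  unfolding positive_on_def by (rule AE_restrict_space_iff) simp

theorem proposition4p1:
  fixes p \<mu> :: real
    and T :: "real \<Rightarrow> 'x::banach_lattice \<Rightarrow> 'x"
    and J :: "'x \<Rightarrow> 'e::banach"
    and Tm :: "real \<Rightarrow> 'e \<Rightarrow> 'e"
    and B :: "'u::banach_lattice \<Rightarrow> 'e"
    and \<Gamma> :: "'e \<Rightarrow> 'y::banach_lattice"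
    and D :: "'u \<Rightarrow> 'y"
    and \<Psi> :: "'x \<Rightarrow> real \<Rightarrow> 'y"
    and F :: "(real \<Rightarrow> 'u) \<Rightarrow> real \<Rightarrow> 'y"
  assumes "1 \<le> p"
    and "control_system T \<mu> J Tm B \<Gamma> D"
    and "well_posed_triplet p T J Tm B \<Gamma> D"
    and "extended_output_map p T (\<lambda>x. \<Gamma> (J x)) \<Psi>"
    and "input_output_map p Tm B \<Gamma> D F"
  shows "(externally_positive p \<Psi> F \<longleftrightarrow> positive_operator (Lp_loc p) {0..} F) \<and>
         (positive_operator (Lp_loc p) {0..} F \<longleftrightarrow>
            (\<forall>t\<ge>0. positive_operator (Lp p {0..t}) {0..t} (truncated_io_map F t)))"
proof (intro conjI iffI allI impI)
  have p: "0 < p" using assms(1) by simp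
  \<comment> \<open>The two outputs differ by \<open>\<Psi> 0\<close>, which vanishes almost
    everywhere; this settles the equivalence of the first two assertions.\<close>
  have out: "positive_on {0..} (system_output \<Psi> F 0 u) \<longleftrightarrow> positive_on {0..} (F u)" for u
    unfolding positive_on_def
  proof (rule eventually_subst)
    show "AE t in lebesgue_on {0..}. (0 \<le> system_output \<Psi> F 0 u t) = (0 \<le> F u t)"
      using extended_output_map_zero[OF assms(2,4)]
      by eventually_elim (simp add: system_output_def)
  qed
  show "positive_operator (Lp_loc p) {0..} F" if "externally_positive p \<Psi> F"
    using that by (simp add: externally_positive_def positive_operator_def out)
  show "externally_positive p \<Psi> F" if "positive_operator (Lp_loc p) {0..} F"
    using that by (simp add: externally_positive_def positive_operator_def out)
  show "positive_operator (Lp p {0..t}) {0..t} (truncated_io_map F t)"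
    if pos: "positive_operator (Lp_loc p) {0..} F" and t: "0 \<le> t" for t
    unfolding positive_operator_def
  proof (intro ballI impI)
    fix u :: "real \<Rightarrow> 'u"
    assume u: "u \<in> Lp p {0..t}" "positive_on {0..t} u"
    \<comment> \<open>\<open>truncated_io_map\<close> feeds exactly this zero extension to
      \<open>F\<close>. It stays positive on all of \<open>{0..}\<close>, so positivity of
      \<open>F\<close> applies to it.\<close>
    let ?u = "\<lambda>s. if s \<in> {0..t} then u s else 0"
    have "positive_on {0..} ?u"
      using u(2) by (simp add: positive_on_iff) (auto elim!: eventually_mono)
    then have "positive_on {0..} (F ?u)"
      using pos Lp_loc_truncate[OF u(1)] unfolding positive_operator_def by blast
    then show "positive_on {0..t} (truncated_io_map F t u)"
      by (simp add: positive_on_iff truncated_io_map_def) (auto elim!: eventually_mono)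
  qed
  show "positive_operator (Lp_loc p) {0..} F"
    if pos: "\<forall>t\<ge>0. positive_operator (Lp p {0..t}) {0..t} (truncated_io_map F t)"
    unfolding positive_operator_def
  proof (intro ballI impI)
    fix u :: "real \<Rightarrow> 'u"
    assume u: "u \<in> Lp_loc p" "positive_on {0..} u"
    \<comment> \<open>Integer horizons keep the exceptional null sets countable in number; they
      start at 1 because causality is stated for positive times.\<close>
    have "AE t in lebesgue. t \<in> {0..real (Suc n)} \<longrightarrow> 0 \<le> F u t" for n
    proof -
      let ?N = "real (Suc n)"
      have "u \<in> Lp p {0..?N}"
        using u(1) by (simp add: Lp_loc_def)
      moreover have "positive_on {0..?N} u"
        using u(2) by (simp add: positive_on_iff) (auto elim!: eventually_mono)
      ultimately have "positive_on {0..?N} (truncated_io_map F ?N u)"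
        using pos unfolding positive_operator_def by simp
      then have "AE t in lebesgue. t \<in> {0..?N} \<longrightarrow> 0 \<le> truncated_io_map F ?N u t"
        by (simp add: positive_on_iff)
      \<comment> \<open>Causality enters here: positivity is known for the response to the truncated
        input, and on \<open>{0..?N}\<close> this is the response to \<open>u\<close>
        itself.\<close>
      moreover have "AE t in lebesgue. t \<in> {0..?N} \<longrightarrow>
          F u t = F (\<lambda>s. if s \<in> {0..?N} then u s else 0) t"
        using input_output_map_causal[OF assms(5) u(1) _ p, of ?N] by (simp add: AE_restrict_space_iff)
      ultimately show ?thesis
        by eventually_elim (simp add: truncated_io_map_def)
    qed
    then have "AE t in lebesgue. \<forall>n. t \<in> {0..real (Suc n)} \<longrightarrow> 0 \<le> F u t"
      by (simp only: AE_all_countable) blast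
    then have "AE t in lebesgue. t \<in> {0..} \<longrightarrow> 0 \<le> F u t"
    proof eventually_elim
      case (elim t)
      obtain n where "t \<le> real n" using real_arch_simple by blast
      then show ?case using elim[rule_format, of n] by auto
    qed
    then show "positive_on {0..} (F u)" by (simp add: positive_on_iff)
  qed
qed

end
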